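(* Let $q$ be an odd prime power and let $\mathcal C$ be an irreducible conic of $\mathrm{PG}(2,q^2)$ which is not defined over $\mathbb F_q$ and has at least one point in $\mathrm{PG}(2,q)$. Then: (i) if $q=3$, $E_q(\mathcal C)\in\{3,4,5,6,7,8,9\}$; (ii) if $q=5$, $E_q(\mathcal C)\in\{11,12,14,15,16,17,19,20,21,22,25\}$; (iii) if $q>5$, then $E_q(\mathcal C)=\frac12\big(q^2+(\alpha-1)q-n_0\big)$ for some $n_0\in\{0,1,2,3\}$ and $\alpha\in\{1,2,3,4,5,7\}$ with $\alpha-n_0$ even.
   Context: $\mathrm{PG}(2,q)$ is regarded as canonically embedded in $\mathrm{PG}(2,q^2)$. A conic is the zero set of a quadratic form $F\in\mathbb F_{q^2}[X_0,X_1,X_2]$; it is irreducible if $F$ is absolutely irreducible, and defined over $\mathbb F_q$ if $F$ is a scalar multiple of a form with coefficients in $\mathbb F_q$. A point not on $\mathcal C$ is external to $\mathcal C$ if it lies on two tangent lines to $\mathcal C$, internal if on none. $E_q(\mathcal C)$ is the number of points of $\mathrm{PG}(2,q)$ external to $\mathcal C$. *)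

theory Defs
  imports "HOL-Algebra.Algebraic_Closure_Type"
begin

type_synonym 'k vec3 = "'k \<times> 'k \<times> 'k"

definition pclass :: "'k::field vec3 \<Rightarrow> 'k vec3 set" where
  "pclass v = {(c * fst v, c * fst (snd v), c * snd (snd v)) | c. c \<noteq> 0}"

definition ppoints :: "'k::field vec3 set set" where
  "ppoints = pclass ` (UNIV - {(0, 0, 0)})"

text \<open>The subfield \<open>F_q\<close> of a field of order \<open>q^2\<close>: the fixed points of the Frobenius \<open>x \<mapsto> x^q\<close>.\<close>
definition subfield_q :: "nat \<Rightarrow> 'k::field set" where
  "subfield_q q = {x. x ^ q = x}"

definition ppoints_q :: "nat \<Rightarrow> 'k::field vec3 set set" where
  "ppoints_q q = {P \<in> ppoints. \<exists>v \<in> P. fst v \<in> subfield_q q \<and> fst (snd v) \<in> subfield_q q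
                                        \<and> snd (snd v) \<in> subfield_q q}"

type_synonym 'k qform = "'k \<times> 'k \<times> 'k \<times> 'k \<times> 'k \<times> 'k"

fun qeval :: "'k::field qform \<Rightarrow> 'k vec3 \<Rightarrow> 'k" where
  "qeval (a, b, c, d, e, f) (x, y, z) = a*x*x + b*y*y + c*z*z + d*x*y + e*x*z + f*y*z"

text \<open>Absolutely irreducible: not a product of two linear forms over the algebraic closure
  (equality of polynomials, i.e. of coefficients).\<close>
fun abs_irreducible :: "'k::field qform \<Rightarrow> bool" where
  "abs_irreducible (a, b, c, d, e, f) \<longleftrightarrow>
     \<not> (\<exists>l1 l2 l3 m1 m2 m3 :: 'k alg_closure.
          to_ac a = l1 * m1 \<and> to_ac b = l2 * m2 \<and> to_ac c = l3 * m3 \<and>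
          to_ac d = l1 * m2 + l2 * m1 \<and> to_ac e = l1 * m3 + l3 * m1 \<and>
          to_ac f = l2 * m3 + l3 * m2)"

fun defined_over_q :: "nat \<Rightarrow> 'k::field qform \<Rightarrow> bool" where
  "defined_over_q q (a, b, c, d, e, f) \<longleftrightarrow>
     (\<exists>s a' b' c' d' e' f'. {a', b', c', d', e', f'} \<subseteq> subfield_q q \<and>
        (a, b, c, d, e, f) = (s*a', s*b', s*c', s*d', s*e', s*f'))"

definition conic :: "'k::field qform \<Rightarrow> 'k vec3 set set" where
  "conic Q = {P \<in> ppoints. \<forall>v \<in> P. qeval Q v = 0}"

definition pline :: "'k::field vec3 \<Rightarrow> 'k vec3 set set" where
  "pline l = {P \<in> ppoints. \<forall>v \<in> P.
      fst l * fst v + fst (snd l) * fst (snd v) + snd (snd l) * snd (snd v) = 0}"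

definition plines :: "'k::field vec3 set set set" where
  "plines = pline ` (UNIV - {(0, 0, 0)})"

definition tangent :: "'k::field qform \<Rightarrow> 'k vec3 set set \<Rightarrow> bool" where
  "tangent Q L \<longleftrightarrow> L \<in> plines \<and> card (L \<inter> conic Q) = 1"

definition external :: "'k::field qform \<Rightarrow> 'k vec3 set \<Rightarrow> bool" where
  "external Q P \<longleftrightarrow> P \<in> ppoints \<and> P \<notin> conic Q \<and> card {L. tangent Q L \<and> P \<in> L} = 2"

definition E_q :: "nat \<Rightarrow> 'k::field qform \<Rightarrow> nat" where
  "E_q q Q = card {P \<in> ppoints_q q. external Q P}"

end

theory Submission
  imports Defs
begin

text \<open>
  Write \<open>K\<close> for the subfield of order \<open>q\<close> and \<open>chi\<close> for the quadratic character of the field of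
  order \<open>q\<^sup>2\<close>. A point \<open>v\<close> is external to \<open>Q\<close> iff \<open>chi (\<delta> * Q(v)) = 1\<close>, where \<open>\<delta>\<close> is minus the
  determinant of \<open>Q\<close> up to a square, so \<open>E_q\<close> is governed by the sum of \<open>chi (\<delta> * Q(v))\<close> over the \<open>K\<close>-rational
  vectors. Take coordinates over \<open>K\<close> with a rational point of the conic as first base point; then
  \<open>Q = x \<ell>(y, z) + Q'(y, z)\<close> is affine in \<open>x\<close>, and the sum over \<open>x\<close> of \<open>chi (x + \<theta>)\<close> is \<open>q - 1\<close> or
  \<open>-1\<close> according to whether \<open>\<theta> = Q' / \<ell>\<close> lies in \<open>K\<close>.

  If \<open>\<ell>\<close> has no zero over \<open>K\<close>, then \<open>w = \<ell>(y, z)\<close> runs through the large field and the condition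
  \<open>Q' / \<ell> \<in> K\<close> becomes a cubic equation for \<open>w\<^bsup>q - 1\<^esup>\<close>. It has at most three roots, and the product
  of its roots restricts the signs with which they contribute. Otherwise \<open>\<ell>\<close> is a multiple of a form
  over \<open>K\<close> and the condition becomes a quadratic equation over \<open>K\<close>, which is nontrivial because \<open>Q\<close>
  is not defined over \<open>K\<close>.
\<close>

section \<open>The quadratic character of a field of order \<open>q\<^sup>2\<close>\<close>

text \<open>The fibre is the root set of the nonzero polynomial \<open>X ^ n - a\<close>. This gives
  the upper bounds in the counts of norms and of \<open>K\<close>.\<close>

lemma card_power_fibre_le:
  fixes a :: "'k::field"
  assumes "n > 0"
  shows "finite {x. x ^ n = a}" "card {x. x ^ n = a} \<le> n"
proof -
  let ?p = "Polynomial.monom 1 n - [:a:]"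
  have deg: "degree ?p = n"
    using assms degree_add_eq_left[of "- [:a:]" "Polynomial.monom 1 n"]
    by (simp add: degree_monom_eq diff_conv_add_uminus del: add_uminus_conv_diff)
  then have "?p \<noteq> 0"
    using assms by auto
  moreover have "{x. x ^ n = a} = {x. poly ?p x = 0}"
    by (simp add: poly_monom)
  ultimately show "finite {x. x ^ n = a}" "card {x. x ^ n = a} \<le> n"
    using card_poly_roots_bound[of ?p] poly_roots_finite[of ?p] deg by simp_all
qed

lemma card_eq_sum_fibres:
  assumes "finite A"
  shows "card A = (\<Sum>y \<in> f ` A. card {x \<in> A. f x = y})"
  using sum.image_gen[OF assms, of "\<lambda>_. 1::nat" f] by simp

definition chi :: "'k::field \<Rightarrow> int" where
  "chi x = (if x = 0 then 0 else if \<exists>s. x = s ^ 2 then 1 else -1)"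

lemma chi_0 [simp]: "chi 0 = 0"
  by (simp add: chi_def)

lemma chi_eq_0_iff [simp]: "chi x = 0 \<longleftrightarrow> x = 0"
  by (simp add: chi_def)

lemma chi_square [simp]: "x \<noteq> 0 \<Longrightarrow> chi (x ^ 2) = 1"
  by (auto simp: chi_def)

lemma chi_nonzero_cases: "x \<noteq> 0 \<Longrightarrow> chi x = 1 \<or> chi x = -1"
  by (simp add: chi_def)

locale quadratic_extension =
  fixes q :: nat and K :: "'k::{field,finite} set"
  assumes q_prime_power: "\<exists>p k. prime p \<and> k > 0 \<and> q = p ^ k"
    and q_odd: "odd q"
    and card_UNIV: "card (UNIV :: 'k set) = q ^ 2"
    and K_eq: "K = subfield_q q"
begin

text \<open>The Frobenius over \<open>K\<close>: an involutive field automorphism with fixed field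
  \<open>K\<close>.\<close>

definition conj :: "'k \<Rightarrow> 'k" where
  "conj x = x ^ q"

lemma q_ge_3: "q \<ge> 3"
proof -
  obtain p k where pk: "prime p" "k > 0" "q = p ^ k"
    using q_prime_power by blast
  then have "q > 1"
    using prime_gt_1_nat one_less_power by blast
  then show ?thesis
    using q_odd by (cases "q = 2") auto
qed

text \<open>Translation by \<open>1\<close> permutes the field, so the sum of all elements does not
  change when \<open>1\<close> is added to each.\<close>

lemma of_nat_card_UNIV: "of_nat (q ^ 2) = (0 :: 'k)"
proof -
  have "(\<Sum>x\<in>UNIV. x :: 'k) = (\<Sum>x\<in>UNIV. x + 1)"
    by (rule sum.reindex_bij_witness[of _ "\<lambda>x. x + 1" "\<lambda>x. x - 1"]) auto
  also have "\<dots> = (\<Sum>x\<in>UNIV. x) + of_nat (q ^ 2)"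
    by (simp add: sum.distrib card_UNIV)
  finally show ?thesis
    by simp
qed

lemma prime_CHAR: "prime (CHAR('k))"
  using of_nat_card_UNIV q_ge_3 by (intro prime_CHAR_semidom) (auto simp: CHAR_pos_iff intro!: exI[of _ "q ^ 2"])

text \<open>This is what makes \<open>x ^ q\<close> additive.\<close>

lemma q_eq_CHAR_power: obtains k where "q = CHAR('k) ^ k"
proof -
  obtain p k where pk: "prime p" "k > 0" "q = p ^ k"
    using q_prime_power by blast
  have "CHAR('k) dvd (p ^ k) ^ 2"
    using of_nat_card_UNIV pk by (metis of_nat_eq_0_iff_char_dvd)
  then have "CHAR('k) = p"
    using prime_CHAR pk by (metis prime_dvd_power primes_dvd_imp_eq)
  with pk that show thesis by blast
qed

lemma two_nonzero: "(2 :: 'k) \<noteq> 0"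
proof
  assume "(2 :: 'k) = 0"
  then have "CHAR('k) dvd 2"
    by (metis of_nat_eq_0_iff_char_dvd of_nat_numeral)
  then have "CHAR('k) = 2"
    using prime_CHAR by (metis primes_dvd_imp_eq two_is_prime_nat)
  with q_odd q_ge_3 show False
    by (metis One_nat_def even_power gcd_nat.refl neq0_conv numeral_le_one_iff power_0 q_eq_CHAR_power semiring_norm(70))
qed

lemma four_nonzero: "(4 :: 'k) \<noteq> 0"
proof -
  have "(4 :: 'k) = 2 * 2" by simp
  then show ?thesis using two_nonzero by (metis mult_eq_0_iff)
qed

section \<open>The Frobenius automorphism, its fixed field and the norm\<close>

lemma conj_add [simp]: "conj (x + y) = conj x + conj y"
  unfolding conj_def by (rule q_eq_CHAR_power) (rule freshmans_dream'[OF prime_CHAR])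

lemma conj_mult [simp]: "conj (x * y) = conj x * conj y"
  by (simp add: conj_def power_mult_distrib)

lemma conj_power [simp]: "conj (x ^ n) = conj x ^ n"
  by (simp add: conj_def power_commutes flip: power_mult) (simp add: mult.commute)

lemma conj_divide [simp]: "conj (x / y) = conj x / conj y"
  by (simp add: conj_def power_divide)

lemma conj_0 [simp]: "conj 0 = 0"
  using q_ge_3 by (simp add: conj_def)

lemma conj_1 [simp]: "conj 1 = 1"
  by (simp add: conj_def)

lemma conj_minus [simp]: "conj (- x) = - conj x"
  using q_odd by (simp add: conj_def)

lemma conj_diff [simp]: "conj (x - y) = conj x - conj y"
  using conj_add[of x "- y"] by simp

lemma conj_eq_0_iff [simp]: "conj x = 0 \<longleftrightarrow> x = 0"
  using q_ge_3 by (simp add: conj_def)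

lemma K_iff: "x \<in> K \<longleftrightarrow> conj x = x"
  by (simp add: K_eq subfield_q_def conj_def)

lemma K_closed [simp]:
  "0 \<in> K" "1 \<in> K" "x \<in> K \<Longrightarrow> y \<in> K \<Longrightarrow> x + y \<in> K" "x \<in> K \<Longrightarrow> y \<in> K \<Longrightarrow> x * y \<in> K"
  "x \<in> K \<Longrightarrow> y \<in> K \<Longrightarrow> x - y \<in> K" "x \<in> K \<Longrightarrow> y \<in> K \<Longrightarrow> x / y \<in> K" "x \<in> K \<Longrightarrow> - x \<in> K"
  by (simp_all add: K_iff)

text \<open>Multiplication by \<open>x\<close> permutes the nonzero elements; comparing their
  products gives the claim.\<close>

lemma power_card_minus_1:
  assumes "(x :: 'k) \<noteq> 0"
  shows "x ^ (q ^ 2 - 1) = 1"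
proof -
  have "(\<Prod>y\<in>UNIV - {0}. x * y) = (\<Prod>y\<in>UNIV - {0}. y)"
    by (rule prod.reindex_bij_witness[of _ "\<lambda>y. y / x" "\<lambda>y. x * y"]) (use assms in auto)
  moreover have "(\<Prod>y\<in>UNIV - {0}. x * y) = x ^ (q ^ 2 - 1) * (\<Prod>y\<in>UNIV - {0}. y)"
    by (simp add: prod.distrib card_Diff_subset card_UNIV)
  ultimately show ?thesis
    by simp
qed

lemma conj_conj [simp]: "conj (conj x) = x"
proof (cases "x = 0")
  case False
  have "q * q = Suc (q ^ 2 - 1)"
    using q_ge_3 by (simp add: power2_eq_square)
  then have "conj (conj x) = x ^ Suc (q ^ 2 - 1)"
    by (simp add: conj_def flip: power_mult)
  with power_card_minus_1[OF False] show ?thesis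
    by simp
qed auto

text \<open>Both claims come from one squeeze. Norm fibres have at most \<open>q + 1\<close>
  elements, so there are at least \<open>q - 1\<close> nonzero norms; they lie in
  \<open>K - {0}\<close>, whose elements are roots of \<open>X ^ (q - 1) - 1\<close>.\<close>

lemma norm_image: "(\<lambda>w. w * conj w) ` (UNIV - {0}) = K - {0}"
  and card_K: "card K = q"
proof -
  let ?N = "\<lambda>w. w * conj w"
  have sub: "?N ` (UNIV - {0}) \<subseteq> K - {0}"
    by (auto simp: K_iff mult.commute)
  have fibre: "card {w \<in> UNIV - {0}. ?N w = y} \<le> q + 1" for y
  proof -
    have "card {w \<in> UNIV - {0}. ?N w = y} \<le> card {w. w ^ (q + 1) = y}"
      by (intro card_mono) (auto simp: conj_def)
    also have "\<dots> \<le> q + 1"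
      by (rule card_power_fibre_le) simp
    finally show ?thesis .
  qed
  have "q ^ 2 - 1 = card (UNIV - {0 :: 'k})"
    by (simp add: card_Diff_subset card_UNIV)
  also have "\<dots> = (\<Sum>y \<in> ?N ` (UNIV - {0}). card {w \<in> UNIV - {0}. ?N w = y})"
    by (rule card_eq_sum_fibres) simp
  also have "\<dots> \<le> card (?N ` (UNIV - {0})) * (q + 1)"
    using sum_bounded_above[of "?N ` (UNIV - {0})" _ "q + 1", OF fibre] by simp
  also have "q ^ 2 - 1 = (q - 1) * (q + 1)"
    by (simp add: power2_eq_square algebra_simps)
  finally have ge: "q - 1 \<le> card (?N ` (UNIV - {0}))"
    using mult_le_cancel2[of "q - 1" "q + 1"] by simp
  have conj_eq_power: "conj x = x * x ^ (q - 1)" for x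
    using q_ge_3 power_minus_mult[of q x] by (simp add: conj_def mult.commute)
  have "{x. x ^ (q - 1) = 1} = K - {0}"
    using q_ge_3 conj_eq_power by (auto simp: K_iff power_0_left)
  then have le: "card (K - {0}) \<le> q - 1"
    using card_power_fibre_le(2)[of "q - 1" "1 :: 'k"] q_ge_3 by simp
  show eq: "?N ` (UNIV - {0}) = K - {0}"
    using ge le by (intro card_seteq[OF _ sub]) auto
  show "card K = q"
    using ge le q_ge_3 card_Diff_singleton[of 0 K] unfolding eq by simp
qed

text \<open>A nonzero element of \<open>K\<close> is a norm \<open>w ^ (q + 1)\<close>, and
  \<open>q + 1\<close> is even. Hence scaling by \<open>K\<close> does not affect
  \<open>chi\<close>.\<close>

lemma chi_K [simp]:
  assumes "x \<in> K" "x \<noteq> 0"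
  shows "chi x = 1"
proof -
  obtain w where w: "w \<noteq> 0" "x = w * conj w"
    using assms norm_image by (metis (no_types, lifting) DiffE DiffI imageE insertI1 singletonD)
  have "x = w ^ (q + 1)"
    using w by (simp add: conj_def)
  also have "\<dots> = (w ^ ((q + 1) div 2)) ^ 2"
    using q_odd by (metis dvd_div_mult_self even_plus_one_iff power_mult)
  finally show ?thesis
    using w by simp
qed

section \<open>Squares, nonsquares and sums of the quadratic character\<close>

lemma card_squares: "2 * card {x :: 'k. chi x = 1} = q ^ 2 - 1"
proof -
  have fibre: "card {s \<in> UNIV - {0}. s ^ 2 = x} = 2" if x: "x \<in> (\<lambda>s. s ^ 2) ` (UNIV - {0 :: 'k})" for x
  proof -
    obtain t where t: "t \<noteq> 0" "x = t ^ 2"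
      using x by auto
    then have "{s \<in> UNIV - {0}. s ^ 2 = x} = {t, - t}"
      by (auto simp: power2_eq_iff)
    moreover have "t \<noteq> - t"
      using t two_nonzero by (metis add_eq_0_iff2 mult_2 mult_eq_0_iff)
    ultimately show ?thesis
      by simp
  qed
  have "q ^ 2 - 1 = card (UNIV - {0 :: 'k})"
    by (simp add: card_Diff_subset card_UNIV)
  also have "\<dots> = (\<Sum>x \<in> (\<lambda>s. s ^ 2) ` (UNIV - {0 :: 'k}). card {s \<in> UNIV - {0}. s ^ 2 = x})"
    by (rule card_eq_sum_fibres) simp
  also have "\<dots> = 2 * card ((\<lambda>s. s ^ 2) ` (UNIV - {0 :: 'k}))"
    using fibre by simp
  also have "(\<lambda>s. s ^ 2) ` (UNIV - {0 :: 'k}) = {x. chi x = 1}"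
    by (auto simp: chi_def)
  finally show ?thesis
    by simp
qed

lemma card_nonsquares: "card {x :: 'k. chi x = - 1} = card {x :: 'k. chi x = 1}"
proof -
  have "UNIV - {0 :: 'k} = {x. chi x = 1} \<union> {x. chi x = - 1}"
    using chi_nonzero_cases by auto
  then have "card (UNIV - {0 :: 'k}) = card {x :: 'k. chi x = 1} + card {x :: 'k. chi x = - 1}"
    by (simp add: card_Un_disjoint disjoint_iff)
  then show ?thesis
    using card_squares by (simp add: card_Diff_subset card_UNIV)
qed

lemma chi_square_mult:
  assumes "chi a = 1"
  shows "chi (a * y) = chi (y :: 'k)"
proof (cases "y = 0")
  case False
  obtain s where s: "s \<noteq> 0" "a = s ^ 2"
    using assms by (auto simp: chi_def split: if_splits)
  have "(\<exists>t. s ^ 2 * y = t ^ 2) \<longleftrightarrow> (\<exists>t. y = t ^ 2)"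
  proof
    assume "\<exists>t. s ^ 2 * y = t ^ 2"
    then obtain t where "s ^ 2 * y = t ^ 2" ..
    then have "y = (t / s) ^ 2"
      using s by (simp add: power_divide field_simps)
    then show "\<exists>t. y = t ^ 2" ..
  next
    assume "\<exists>t. y = t ^ 2"
    then obtain t where "y = t ^ 2" ..
    then have "s ^ 2 * y = (s * t) ^ 2"
      by (simp add: power_mult_distrib)
    then show "\<exists>t. s ^ 2 * y = t ^ 2" ..
  qed
  then show ?thesis
    using s False by (simp add: chi_def)
qed auto

text \<open>Multiplication by a nonsquare maps the squares injectively into the equally many
  nonsquares, hence onto them.\<close>
lemma chi_mult: "chi (x * y) = chi x * chi (y :: 'k)"
proof (cases "x = 0 \<or> y = 0")
  case False
  consider "chi x = 1" | "chi y = 1" | "chi x = -1" "chi y = -1"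
    using False chi_nonzero_cases by metis
  then show ?thesis
  proof cases
    case 3
    have sub: "(*) x ` {a. chi a = 1} \<subseteq> {a. chi a = -1}"
      using chi_square_mult[of _ x] 3 by (auto simp: mult.commute)
    have "(*) x ` {a. chi a = 1} = {a. chi a = -1}"
      using sub False by (intro card_subset_eq) (auto simp: card_nonsquares card_image inj_on_def)
    then obtain a where "chi a = 1" "y = x * a"
      using 3 by blast
    then show ?thesis
      using 3 False chi_square_mult[of a "x ^ 2"] chi_square[of x] by (simp add: power2_eq_square mult_ac)
  qed (use chi_square_mult[of x y] chi_square_mult[of y x] in \<open>auto simp: mult.commute\<close>)
qed auto

lemma sum_chi_UNIV: "(\<Sum>x\<in>UNIV. chi (x :: 'k)) = 0"
proof -
  have "(\<Sum>x\<in>UNIV. chi (x :: 'k)) = (\<Sum>x\<in>{x :: 'k. chi x = 1} \<union> {x. chi x = - 1}. chi x)"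
    by (intro sum.mono_neutral_right) (auto dest: chi_nonzero_cases)
  also have "\<dots> = (\<Sum>x | chi (x :: 'k) = 1. chi x) + (\<Sum>x | chi (x :: 'k) = - 1. chi x)"
    by (intro sum.union_disjoint) auto
  finally show ?thesis
    by (simp add: card_nonsquares)
qed

lemma sum_chi_K: "(\<Sum>x\<in>K. chi x) = int q - 1"
proof -
  have "(\<Sum>x\<in>K. chi x) = (\<Sum>x\<in>K - {0}. chi x)"
    by (intro sum.mono_neutral_right) auto
  also have "\<dots> = int (card (K - {0}))"
    by simp
  finally show ?thesis
    using q_ge_3 card_Diff_singleton[of 0 K] by (simp add: card_K of_nat_diff)
qed

text \<open>For \<open>\<theta> \<notin> K\<close> the elements of the field are the \<open>s + u \<theta>\<close> with \<open>s, u \<in> K\<close>, and the lines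
  \<open>u \<noteq> 0\<close> contribute equally to the vanishing sum of \<open>chi\<close> over the whole field.\<close>
lemma sum_chi_shift: "(\<Sum>s\<in>K. chi (s + \<theta>)) = (if \<theta> \<in> K then int q - 1 else - 1)"
proof (cases "\<theta> \<in> K")
  case True
  have "(\<Sum>s\<in>K. chi (s + \<theta>)) = (\<Sum>s\<in>K. chi s)"
    by (rule sum.reindex_bij_witness[of _ "\<lambda>s. s - \<theta>" "\<lambda>s. s + \<theta>"]) (use True in auto)
  with True sum_chi_K show ?thesis
    by simp
next
  case False
  let ?X = "\<Sum>s\<in>K. chi (s + \<theta>)"
  let ?g = "\<lambda>(u, s). s + u * \<theta>"
  have inj: "inj_on ?g (K \<times> K)"
  proof (rule inj_onI, clarify)
    fix u s u' s' assume K: "u \<in> K" "s \<in> K" "u' \<in> K" "s' \<in> K" and eq: "s + u * \<theta> = s' + u' * \<theta>"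
    have "u = u'"
    proof (rule ccontr)
      assume "u \<noteq> u'"
      then have "\<theta> = (s' - s) / (u - u')"
        using eq by (simp add: field_simps)
      with K False show False
        by simp
    qed
    with eq show "u = u' \<and> s = s'"
      by simp
  qed
  have surj: "?g ` (K \<times> K) = UNIV"
    using inj by (intro card_subset_eq) (auto simp: card_image card_cartesian_product card_K card_UNIV power2_eq_square)
  have line: "(\<Sum>s\<in>K. chi (s + u * \<theta>)) = ?X" if u: "u \<in> K - {0}" for u
  proof -
    have "(\<Sum>s\<in>K. chi (s + u * \<theta>)) = (\<Sum>s\<in>K. chi (u * (s + \<theta>)))"
      by (rule sum.reindex_bij_witness[of _ "\<lambda>s. u * s" "\<lambda>s. s / u"]) (use u in \<open>auto simp: algebra_simps\<close>)
    also have "\<dots> = ?X"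
      using u by (simp add: chi_mult)
    finally show ?thesis .
  qed
  have "0 = (\<Sum>x\<in>?g ` (K \<times> K). chi x)"
    by (simp add: surj sum_chi_UNIV)
  also have "\<dots> = (\<Sum>(u, s)\<in>K \<times> K. chi (s + u * \<theta>))"
    by (subst sum.reindex[OF inj]) (auto intro: sum.cong)
  also have "\<dots> = (\<Sum>u\<in>K. \<Sum>s\<in>K. chi (s + u * \<theta>))"
    by (simp add: sum.cartesian_product)
  also have "\<dots> = (\<Sum>s\<in>K. chi s) + (\<Sum>u\<in>K - {0}. \<Sum>s\<in>K. chi (s + u * \<theta>))"
    by (subst sum.remove[of _ 0]) auto
  also have "\<dots> = (int q - 1) + (int q - 1) * ?X"
    using line card_Diff_singleton[of 0 K] q_ge_3 by (simp add: sum_chi_K card_K of_nat_diff)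
  finally have "(int q - 1) * (1 + ?X) = 0"
    by (simp only: distrib_left mult_1_right)
  then have "1 + ?X = 0"
    using q_ge_3 by (simp only: mult_eq_0_iff) linarith
  then show ?thesis
    using False by simp
qed

end

section \<open>Ternary quadratic forms and the projective plane\<close>

text \<open>The symmetric bilinear form \<open>Q(v + v') - Q(v) - Q(v')\<close>; on the diagonal it
  is twice the quadratic form.\<close>

fun polar :: "'k::field qform \<Rightarrow> 'k vec3 \<Rightarrow> 'k vec3 \<Rightarrow> 'k" where
  "polar (a, b, c, d, e, f) (x, y, z) (x', y', z') =
     2*a*x*x' + 2*b*y*y' + 2*c*z*z' + d*(x*y' + y*x') + e*(x*z' + z*x') + f*(y*z' + z*y')"

text \<open>Minus one half of the determinant of the Gram matrix of \<open>polar\<close>; with this sign, \<open>v\<close> is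
  external iff \<open>qdisc Q * qeval Q v\<close> is a nonzero square.\<close>
fun qdisc :: "'k::field qform \<Rightarrow> 'k" where
  "qdisc (a, b, c, d, e, f) = a*f*f + b*e*e + c*d*d - 4*a*b*c - d*e*f"

fun det3 :: "'k::field vec3 \<Rightarrow> 'k vec3 \<Rightarrow> 'k vec3 \<Rightarrow> 'k" where
  "det3 (x, y, z) (x', y', z') (x'', y'', z'') =
     x*(y'*z'' - z'*y'') - y*(x'*z'' - z'*x'') + z*(x'*y'' - y'*x'')"

fun lincomb :: "'k::field vec3 \<Rightarrow> 'k vec3 \<Rightarrow> 'k vec3 \<Rightarrow> 'k vec3 \<Rightarrow> 'k vec3" where
  "lincomb (x1, x2, x3) (y1, y2, y3) (z1, z2, z3) (x, y, z)
      = (x*x1 + y*y1 + z*z1, x*x2 + y*y2 + z*z2, x*x3 + y*y3 + z*z3)"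

text \<open>The coefficients of \<open>Q\<close> in coordinates with respect to the basis
  \<open>u\<close>, \<open>v\<close>, \<open>w\<close>.\<close>

definition qchange :: "'k::field vec3 \<Rightarrow> 'k vec3 \<Rightarrow> 'k vec3 \<Rightarrow> 'k qform \<Rightarrow> 'k qform" where
  "qchange u v w Q = (qeval Q u, qeval Q v, qeval Q w, polar Q u v, polar Q u w, polar Q v w)"

lemma qeval_lincomb: "qeval Q (lincomb u v w x) = qeval (qchange u v w Q) x"
proof -
  obtain a b c d e f where [simp]: "Q = (a, b, c, d, e, f)" by (cases Q)
  obtain u1 u2 u3 where [simp]: "u = (u1, u2, u3)" by (cases u)
  obtain v1 v2 v3 where [simp]: "v = (v1, v2, v3)" by (cases v)
  obtain w1 w2 w3 where [simp]: "w = (w1, w2, w3)" by (cases w)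
  obtain x1 x2 x3 where [simp]: "x = (x1, x2, x3)" by (cases x)
  show ?thesis unfolding qchange_def by (simp, Groebner_Basis.algebra)
qed

text \<open>The Gram matrix changes by congruence, so its determinant gains the square of the base
  change determinant. The square class of \<open>qdisc Q * qeval Q v\<close> is thus independent of
  coordinates.\<close>

lemma qdisc_qchange: "qdisc (qchange u v w Q) = det3 u v w ^ 2 * qdisc Q"
proof -
  obtain a b c d e f where [simp]: "Q = (a, b, c, d, e, f)" by (cases Q)
  obtain u1 u2 u3 where [simp]: "u = (u1, u2, u3)" by (cases u)
  obtain v1 v2 v3 where [simp]: "v = (v1, v2, v3)" by (cases v)
  obtain w1 w2 w3 where [simp]: "w = (w1, w2, w3)" by (cases w)
  show ?thesis
    unfolding qchange_def
    by (simp only: \<open>Q = _\<close> \<open>u = _\<close> \<open>v = _\<close> \<open>w = _\<close> qeval.simps polar.simps qdisc.simps det3.simps)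
      Groebner_Basis.algebra
qed

lemma det3_lincomb:
  "det3 (lincomb u v w (x, y, z)) v w = x * det3 u v w"
  "det3 u (lincomb u v w (x, y, z)) w = y * det3 u v w"
  "det3 u v (lincomb u v w (x, y, z)) = z * det3 u v w"
  by (cases u; cases v; cases w; simp add: algebra_simps)+

lemma lincomb_inject:
  assumes "det3 u v w \<noteq> 0"
  shows "lincomb u v w x = lincomb u v w y \<longleftrightarrow> x = y"
proof
  assume eq: "lincomb u v w x = lincomb u v w y"
  obtain x1 x2 x3 where x: "x = (x1, x2, x3)" by (cases x)
  obtain y1 y2 y3 where y: "y = (y1, y2, y3)" by (cases y)
  show "x = y"
    using eq assms det3_lincomb[of u v w x1 x2 x3] det3_lincomb[of u v w y1 y2 y3]
    by (auto simp: x y)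
qed auto

lemma lincomb_cramer:
  assumes "det3 u v w \<noteq> 0"
  shows "lincomb u v w (det3 z v w / det3 u v w, det3 u z w / det3 u v w, det3 u v z / det3 u v w) = z"
proof -
  obtain u1 u2 u3 where u: "u = (u1, u2, u3)" by (cases u)
  obtain v1 v2 v3 where v: "v = (v1, v2, v3)" by (cases v)
  obtain w1 w2 w3 where w: "w = (w1, w2, w3)" by (cases w)
  obtain z1 z2 z3 where z: "z = (z1, z2, z3)" by (cases z)
  define d where "d = det3 u v w"
  have d: "d \<noteq> 0" "d = det3 u v w"
    using assms by (simp_all add: d_def)
  have "det3 z v w * u1 + det3 u z w * v1 + det3 u v z * w1 = d * z1"
    "det3 z v w * u2 + det3 u z w * v2 + det3 u v z * w2 = d * z2"
    "det3 z v w * u3 + det3 u z w * v3 + det3 u v z * w3 = d * z3"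
    by (simp_all only: d(2) u v w z det3.simps) (Groebner_Basis.algebra)+
  then show ?thesis
    using d(1) unfolding d(2)[symmetric]
    by (simp add: u v w z field_simps del: det3.simps)
qed

section \<open>Points, lines and conics in terms of representative vectors\<close>

definition smul :: "'k::field \<Rightarrow> 'k vec3 \<Rightarrow> 'k vec3" where
  "smul c v = (c * fst v, c * fst (snd v), c * snd (snd v))"

definition dot :: "'k::field vec3 \<Rightarrow> 'k vec3 \<Rightarrow> 'k" where
  "dot l v = fst l * fst v + fst (snd l) * fst (snd v) + snd (snd l) * snd (snd v)"

lemma smul_smul [simp]: "smul c (smul d v) = smul (c * d) v"
  and smul_1 [simp]: "smul 1 v = v"
  by (simp_all add: smul_def)

lemma smul_eq_0_iff [simp]: "smul c v = (0, 0, 0) \<longleftrightarrow> c = 0 \<or> v = (0, 0, 0)"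
  by (cases v) (auto simp: smul_def)

lemma smul_right_cancel: "v \<noteq> (0, 0, 0) \<Longrightarrow> smul c v = smul d v \<longleftrightarrow> c = d"
  by (cases v) (auto simp: smul_def)

lemma qeval_smul [simp]: "qeval Q (smul c v) = c ^ 2 * qeval Q v"
  by (cases Q; cases v) (simp add: smul_def algebra_simps power2_eq_square)

lemma dot_smul [simp]: "dot l (smul c v) = c * dot l v"
  by (cases l; cases v) (simp add: smul_def dot_def algebra_simps)

lemma dot_lincomb: "dot l (lincomb u v w (x, y, z)) = x * dot l u + y * dot l v + z * dot l w"
  by (cases l; cases u; cases v; cases w) (simp add: dot_def algebra_simps)

lemma smul_lincomb: "smul c (lincomb u v w (x, y, z)) = lincomb u v w (c * x, c * y, c * z)"
  by (cases u; cases v; cases w) (simp add: smul_def algebra_simps)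

lemma lincomb_0 [simp]: "lincomb u v w (0, 0, 0) = (0, 0, 0)"
  and lincomb_1 [simp]: "lincomb u v w (1, 0, 0) = u"
  by (cases u; cases v; cases w; simp)+

lemma pclass_smul_def: "pclass v = {smul c v | c. c \<noteq> 0}"
  by (simp add: pclass_def smul_def)

lemma self_in_pclass: "v \<in> pclass v"
  unfolding pclass_smul_def by (metis (mono_tags, lifting) mem_Collect_eq smul_1 zero_neq_one)

lemma pclass_eq_iff: "pclass v = pclass w \<longleftrightarrow> (\<exists>c. c \<noteq> 0 \<and> w = smul c v)"
proof
  assume "pclass v = pclass w"
  then have "w \<in> pclass v"
    using self_in_pclass by blast
  then show "\<exists>c. c \<noteq> 0 \<and> w = smul c v"
    by (auto simp: pclass_smul_def)
next
  assume "\<exists>c. c \<noteq> 0 \<and> w = smul c v"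
  then obtain c where c: "c \<noteq> 0" "w = smul c v"
    by blast
  then show "pclass v = pclass w"
    unfolding pclass_smul_def
  proof (intro equalityI subsetI)
    fix z assume "z \<in> {smul d v | d. d \<noteq> 0}"
    then obtain d where "d \<noteq> 0" "z = smul d v"
      by blast
    then have "d / c \<noteq> 0" "z = smul (d / c) w"
      using c by simp_all
    then show "z \<in> {smul d w | d. d \<noteq> 0}"
      by blast
  next
    fix z assume "z \<in> {smul d w | d. d \<noteq> 0}"
    then obtain d where "d \<noteq> 0" "z = smul d w"
      by blast
    then have "d * c \<noteq> 0" "z = smul (d * c) v"
      using c by simp_all
    then show "z \<in> {smul d v | d. d \<noteq> 0}"
      by blast
  qed
qed

lemma pclass_in_ppoints [simp]: "pclass v \<in> ppoints \<longleftrightarrow> v \<noteq> (0, 0, 0)"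
proof
  assume "pclass v \<in> ppoints"
  then obtain w where "w \<noteq> (0, 0, 0)" "pclass v = pclass w"
    by (auto simp: ppoints_def)
  then show "v \<noteq> (0, 0, 0)"
    by (auto simp: pclass_eq_iff smul_def)
qed (auto simp: ppoints_def)

lemma ppointsE:
  assumes "P \<in> ppoints"
  obtains v where "v \<noteq> (0, 0, 0)" "P = pclass v"
  using assms by (auto simp: ppoints_def)

text \<open>By homogeneity, vanishing on the whole class can be tested at one
  representative.\<close>

lemma pclass_in_conic [simp]: "pclass v \<in> conic Q \<longleftrightarrow> v \<noteq> (0, 0, 0) \<and> qeval Q v = 0"
  proof -
  have "pclass v \<in> conic Q \<longleftrightarrow> v \<noteq> (0, 0, 0) \<and> (\<forall>w\<in>pclass v. qeval Q w = 0)"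
    by (simp add: conic_def)
  moreover have "(\<forall>w\<in>pclass v. qeval Q w = 0) \<longleftrightarrow> qeval Q v = 0"
    using self_in_pclass by (auto simp: pclass_smul_def simp del: split_paired_All)
  ultimately show ?thesis
    by simp
qed

lemma pclass_in_pline [simp]: "pclass v \<in> pline l \<longleftrightarrow> v \<noteq> (0, 0, 0) \<and> dot l v = 0"
proof -
  have "pclass v \<in> pline l \<longleftrightarrow> v \<noteq> (0, 0, 0) \<and> (\<forall>w\<in>pclass v. dot l w = 0)"
    by (simp add: pline_def dot_def)
  moreover have "(\<forall>w\<in>pclass v. dot l w = 0) \<longleftrightarrow> dot l v = 0"
    using self_in_pclass by (auto simp: pclass_smul_def simp del: split_paired_All)
  ultimately show ?thesis
    by simp
qed

lemma dot_eq_0_imp: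
  assumes "det3 u v w \<noteq> 0" "dot l u = 0" "dot l v = 0" "dot l w = 0"
  shows "l = (0, 0, 0)"
proof -
  have z: "dot l z = 0" for z
    by (subst lincomb_cramer[OF assms(1), of z, symmetric]) (simp add: dot_lincomb assms)
  show ?thesis
    using z[of "(1, 0, 0)"] z[of "(0, 1, 0)"] z[of "(0, 0, 1)"] by (cases l) (simp add: dot_def)
qed

text \<open>Every pair of values on \<open>v\<close> and \<open>w\<close> is attained by a linear
  form vanishing at \<open>u\<close>; this parametrises the lines through a point.\<close>

lemma dot_prescribed:
  assumes "det3 u v w \<noteq> 0"
  obtains l where "dot l u = 0" "dot l v = \<alpha>" "dot l w = \<beta>"
proof -
  obtain u1 u2 u3 where u: "u = (u1, u2, u3)" by (cases u)
  obtain v1 v2 v3 where v: "v = (v1, v2, v3)" by (cases v)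
  obtain w1 w2 w3 where w: "w = (w1, w2, w3)" by (cases w)
  \<comment> \<open>A combination of the cross products of \<open>w\<close>, \<open>u\<close> and of
    \<open>u\<close>, \<open>v\<close>, which up to the factor \<open>det3 u v w\<close> are the
    dual basis vectors of \<open>v\<close> and \<open>w\<close>.\<close>
  define l where "l = (\<alpha> * (w2 * u3 - w3 * u2) + \<beta> * (u2 * v3 - u3 * v2),
    \<alpha> * (w3 * u1 - w1 * u3) + \<beta> * (u3 * v1 - u1 * v3),
    \<alpha> * (w1 * u2 - w2 * u1) + \<beta> * (u1 * v2 - u2 * v1))"
  have *: "dot l u = 0" "dot l v = \<alpha> * det3 u v w" "dot l w = \<beta> * det3 u v w"
    by (simp_all add: l_def u v w dot_def algebra_simps)
  have "dot (smul (1 / det3 u v w) l) x = dot l x / det3 u v w" for x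
    by (simp add: smul_def dot_def add_divide_distrib)
  then show thesis
    using * assms by (intro that[of "smul (1 / det3 u v w) l"]) simp_all
qed

text \<open>Standard unit vectors suffice, so a rational \<open>v\<close> is completed to a rational
  basis.\<close>

lemma basis_completion:
  assumes "v \<noteq> (0, 0, 0)"
  obtains i j where "det3 v i j \<noteq> 0" "{i, j} \<subseteq> {(1, 0, 0), (0, 1, 0), (0, 0, 1)}"
proof -
  obtain a b c where v: "v = (a, b, c)" by (cases v)
  consider "a \<noteq> 0" | "b \<noteq> 0" | "c \<noteq> 0"
    using assms v by auto
  then show thesis
  proof cases
    case 1
    then show ?thesis by (intro that[of "(0, 1, 0)" "(0, 0, 1)"]) (auto simp: v)
  next
    case 2
    then show ?thesis by (intro that[of "(1, 0, 0)" "(0, 0, 1)"]) (auto simp: v)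
  next
    case 3
    then show ?thesis by (intro that[of "(1, 0, 0)" "(0, 1, 0)"]) (auto simp: v)
  qed
qed

section \<open>Irreducible forms have nonzero discriminant\<close>

lemma abs_irreducible_swap12:
  "abs_irreducible (a, b, c, d, e, f) \<Longrightarrow> abs_irreducible (b, a, c, d, f, e)"
  unfolding abs_irreducible.simps by (metis add.commute)

lemma abs_irreducible_swap13:
  "abs_irreducible (a, b, c, d, e, f) \<Longrightarrow> abs_irreducible (c, b, a, f, e, d)"
  unfolding abs_irreducible.simps by (metis add.commute)

lemma not_abs_irreducibleI:
  fixes a :: "'k::field"
  assumes "to_ac a = l1 * m1" "to_ac b = l2 * m2" "to_ac c = l3 * m3"
    "to_ac d = l1 * m2 + l2 * m1" "to_ac e = l1 * m3 + l3 * m1" "to_ac f = l2 * m3 + l3 * m2"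
  shows "\<not> abs_irreducible (a, b, c, d, e, f)"
  unfolding abs_irreducible.simps using assms by blast

text \<open>Completing the square: \<open>4 a F\<close> is the difference of \<open>(2 a x + d y + e z)\<^sup>2\<close> and a binary form
  in \<open>y, z\<close> whose discriminant is a multiple of \<open>qdisc\<close>.\<close>
lemma not_abs_irreducible_if_lead:
  fixes a :: "'k::field"
  assumes two: "(2 :: 'k) \<noteq> 0" and a: "a \<noteq> 0" and 0: "qdisc (a, b, c, d, e, f) = 0"
  shows "\<not> abs_irreducible (a, b, c, d, e, f)"
proof -
  define a' b' c' d' e' f' where defs: "a' = to_ac a" "b' = to_ac b" "c' = to_ac c"
    "d' = to_ac d" "e' = to_ac e" "f' = to_ac f"
  have two': "(2 :: 'k alg_closure) \<noteq> 0"
    using two by (metis to_ac_eq_0_iff to_ac_numeral)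
  have a': "a' \<noteq> 0"
    using a by (simp add: defs)
  have "to_ac (qdisc (a, b, c, d, e, f)) = 0"
    unfolding 0 by simp
  then have zero: "a' * f' * f' + b' * e' * e' + c' * d' * d' - 4 * a' * b' * c' - d' * e' * f' = 0"
    by (simp add: defs)
  obtain g where g: "g ^ 2 = d' ^ 2 - 4 * a' * b'"
    using nth_root_exists[of 2] by (metis zero_less_numeral)
  obtain h0 where h0: "h0 ^ 2 = e' ^ 2 - 4 * a' * c'"
    using nth_root_exists[of 2] by (metis zero_less_numeral)
  have "(2 * g * h0) ^ 2 = 4 * g ^ 2 * h0 ^ 2"
    by Groebner_Basis.algebra
  also have "\<dots> = (2 * d' * e' - 4 * a' * f') ^ 2"
    unfolding g h0 using zero by Groebner_Basis.algebra
  finally have sign: "2 * g * h0 = 2 * d' * e' - 4 * a' * f' \<or> 2 * g * h0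
      = - (2 * d' * e' - 4 * a' * f')"
    by (simp only: power2_eq_iff)
  \<comment> \<open>The roots \<open>g\<close> and \<open>h0\<close> were chosen independently, so
    their product has the right value only up to sign; \<open>h\<close> is \<open>h0\<close> or
    \<open>- h0\<close>.\<close>
  obtain h where h: "h ^ 2 = e' ^ 2 - 4 * a' * c'" "2 * g * h = 2 * d' * e' - 4 * a' * f'"
  proof (cases "2 * g * h0 = 2 * d' * e' - 4 * a' * f'")
    case True
    then show thesis using h0 that by blast
  next
    case False
    then have "2 * g * (- h0) = 2 * d' * e' - 4 * a' * f'"
      using sign by (simp only: mult_minus_right minus_minus) simp
    then show thesis using h0 that[of "- h0"] by simp
  qed
  have four: "(4 :: 'k alg_closure) \<noteq> 0"
    using two' by (metis mult_eq_0_iff mult_2 numeral_Bit0)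
  \<comment> \<open>The difference of squares \<open>(2 a x + d y + e z)^2 - (g y + h z)^2\<close>
    splits. Dividing one factor by \<open>2 a\<close> and the other by \<open>2\<close> gives lines
    with first coefficients \<open>1\<close> and \<open>a\<close>.\<close>
  have "to_ac b = (d' ^ 2 - g ^ 2) / (4 * a')" "to_ac c = (e' ^ 2 - h ^ 2) / (4 * a')"
    unfolding g h(1) using a' four by (simp_all add: defs)
  then have eqs1: "to_ac b = (d' - g) / (2 * a') * ((d' + g) / 2)" "to_ac c
      = (e' - h) / (2 * a') * ((e' + h) / 2)"
    by (simp_all add: power2_eq_square algebra_simps)
  have eqs2: "to_ac d = 1 * ((d' + g) / 2) + (d' - g) / (2 * a') * a'"
    "to_ac e = 1 * ((e' + h) / 2) + (e' - h) / (2 * a') * a'"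
    using a' two' unfolding defs(4,5)[symmetric] by (simp_all add: field_simps)
  have eq3: "to_ac f = (d' - g) / (2 * a') * ((e' + h) / 2) + (e' - h) / (2 * a') * ((d' + g) / 2)"
  proof -
    have "(d' - g) / (2 * a') * ((e' + h) / 2) + (e' - h) / (2 * a') * ((d' + g) / 2)
        = ((d' - g) * (e' + h) + (e' - h) * (d' + g)) / (4 * a')"
    proof -
      have "2 * a' * 2 = 4 * a'"
        by simp
      then show ?thesis
        by (simp only: times_divide_times_eq flip: add_divide_distrib)
    qed
    also have "(d' - g) * (e' + h) + (e' - h) * (d' + g) = 2 * d' * e' - 2 * g * h"
      by Groebner_Basis.algebra
    also have "\<dots> / (4 * a') = f'"
      unfolding h(2) using a' four by simp
    finally show ?thesis
      by (simp add: defs)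
  qed
  have "to_ac a = 1 * a'"
    by (simp add: defs)
  then show ?thesis
    by (rule not_abs_irreducibleI) (rule eqs1 eqs2 eq3)+
qed

text \<open>A nonzero square coefficient can be moved to first place by exchanging variables, and
  then completing the square applies. Without square terms the discriminant is
  \<open>- d * e * f\<close>, so one mixed term is missing and a variable splits off.\<close>

lemma qdisc_nonzero:
  fixes Q :: "'k::field qform"
  assumes two: "(2 :: 'k) \<noteq> 0" and irr: "abs_irreducible Q"
  shows "qdisc Q \<noteq> 0"
proof
  assume 0: "qdisc Q = 0"
  obtain a b c d e f where Q: "Q = (a, b, c, d, e, f)"
    by (cases Q)
  have disc: "qdisc (b, a, c, d, f, e) = 0" "qdisc (c, b, a, f, e, d) = 0"
    using 0 by (simp_all add: Q algebra_simps)
  have "a = 0" "b = 0" "c = 0"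
    using irr abs_irreducible_swap12 abs_irreducible_swap13 not_abs_irreducible_if_lead[OF two] 0 disc
    unfolding Q by blast+
  moreover from this 0 have "d = 0 \<or> e = 0 \<or> f = 0"
    by (simp add: Q)
  then consider "d = 0" | "e = 0" | "f = 0"
    by blast
  then have "\<not> abs_irreducible (0, 0, 0, d, e, f)"
  proof cases
    case 1
    then show ?thesis
      by (intro not_abs_irreducibleI[of _ "to_ac e" 0 _ "to_ac f" 0 _ 0 1]) simp_all
  next
    case 2
    then show ?thesis
      by (intro not_abs_irreducibleI[of _ "to_ac d" 0 _ 0 1 _ "to_ac f" 0]) simp_all
  next
    case 3
    then show ?thesis
      by (intro not_abs_irreducibleI[of _ 0 1 _ "to_ac d" 0 _ "to_ac e" 0]) simp_all
  qed
  ultimately show False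
    using irr unfolding Q by (simp only: not_True_eq_False)
qed

section \<open>External points\<close>

context quadratic_extension
begin

text \<open>Completing the square matches the roots with the square roots of the discriminant, of
  which there are \<open>0\<close>, \<open>1\<close> or \<open>2\<close> according to
  \<open>chi\<close>.\<close>

lemma card_quadratic_roots:
  assumes "(p :: 'k) \<noteq> 0"
  shows "int (card {x. p * x ^ 2 + r * x + t = 0}) = 1 + chi (r ^ 2 - 4 * p * t)"
proof -
  let ?D = "r ^ 2 - 4 * p * t"
  have "4 * p * (p * x ^ 2 + r * x + t) = (2 * p * x + r) ^ 2 - ?D" for x
    by (simp add: power2_eq_square algebra_simps)
  then have root_iff: "p * x ^ 2 + r * x + t = 0 \<longleftrightarrow> (2 * p * x + r) ^ 2 = ?D" for x
    using assms four_nonzero by (metis eq_iff_diff_eq_0 mult_eq_0_iff)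
  show ?thesis
  proof (cases "\<exists>s. ?D = s ^ 2")
    case True
    then obtain s where s: "?D = s ^ 2" by blast
    have "{x. p * x ^ 2 + r * x + t = 0} = {(s - r) / (2 * p), (- s - r) / (2 * p)}"
      unfolding root_iff s power2_eq_iff using assms two_nonzero
      by (auto simp: field_simps)
    moreover have "(s - r) / (2 * p) = (- s - r) / (2 * p) \<longleftrightarrow> 2 * s = 0"
      using assms two_nonzero by (auto simp: field_simps)
    ultimately show ?thesis
      using s two_nonzero by (cases "s = 0") simp_all
  next
    case False
    then have "p * x ^ 2 + r * x + t \<noteq> 0" for x
      by (metis root_iff)
    then have "{x. p * x ^ 2 + r * x + t = 0} = {}"
      by simp
    moreover have "?D \<noteq> 0"
      using False by (metis power_zero_numeral)
    ultimately show ?thesis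
      using False by (simp add: chi_def)
  qed
qed

text \<open>The line through \<open>v\<close> in the direction \<open>D\<close> is tangent iff the discriminant of the quadratic
  \<open>Q (s v + D)\<close> in \<open>s\<close> vanishes. This discriminant is a binary quadratic form in \<open>D\<close> modulo \<open>v\<close>, whose
  own discriminant is a square multiple of \<open>qdisc Q * qeval Q v\<close>.\<close>
lemma external_iff:
  fixes Q :: "'k qform"
  assumes Q: "qdisc Q \<noteq> 0" and v: "v \<noteq> (0, 0, 0)"
  shows "external Q (pclass v) \<longleftrightarrow> chi (qdisc Q * qeval Q v) = 1"
proof (cases "qeval Q v = 0")
  case True
  then show ?thesis
    using v by (simp add: external_def)
next
  case False
  obtain u w where det: "det3 v u w \<noteq> 0"
    using v by (rule basis_completion)
  obtain A b c d e f where Q': "qchange v u w Q = (A, b, c, d, e, f)"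
    by (cases "qchange v u w Q")
  have A: "A = qeval Q v"
    using Q' by (simp add: qchange_def)
  \<comment> \<open>The discriminant in \<open>s\<close> of \<open>Q\<close> at
    \<open>s v + x u + y w\<close>.\<close>
  define D where "D x y = (d * x + e * y) ^ 2 - 4 * A * (b * x ^ 2 + c * y ^ 2 + f * x * y)" for x y
  have qeval: "qeval Q (lincomb v u w (s, x, y))
      = A * s ^ 2 + (d * x + e * y) * s + (b * x ^ 2 + c * y ^ 2 + f * x * y)" for s x y
    by (simp add: qeval_lincomb Q' power2_eq_square algebra_simps)
  \<comment> \<open>The line whose linear form kills \<open>v\<close> and takes the values
    \<open>\<alpha>\<close>, \<open>\<beta>\<close> at \<open>u\<close>, \<open>w\<close>: its
    direction modulo \<open>v\<close> is \<open>(\<beta>, - \<alpha>)\<close>, and \<open>v\<close>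
    is the point at infinity of the parametrisation.\<close>
  define line where "line \<alpha> \<beta> = insert (pclass v) (range (\<lambda>s. pclass (lincomb v u w (s, \<beta>, - \<alpha>))))"
      for \<alpha> \<beta>
  have coords: "\<exists>s x y. z = lincomb v u w (s, x, y)" for z
    using lincomb_cramer[OF det] by metis
  have lincomb_eq_0: "lincomb v u w x = (0, 0, 0) \<longleftrightarrow> x = (0, 0, 0)" for x
    using lincomb_inject[OF det, of x "(0, 0, 0)"] by simp
  have pclass_eq: "pclass (lincomb v u w (s, x, y)) = pclass (lincomb v u w (s', x', y')) \<longleftrightarrow>
      (\<exists>k. k \<noteq> 0 \<and> s' = k * s \<and> x' = k * x \<and> y' = k * y)" for s x y s' x' y'
    by (simp add: pclass_eq_iff smul_lincomb lincomb_inject[OF det])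
  have pclass_v: "pclass v = pclass (lincomb v u w (1, 0, 0))"
    by simp
  have pline_eq: "pline l = line (dot l u) (dot l w)" if l: "l \<noteq> (0, 0, 0)" "dot l v = 0" for l
  proof (rule Set.set_eqI)
    fix P :: "'k vec3 set"
    show "P \<in> pline l \<longleftrightarrow> P \<in> line (dot l u) (dot l w)"
    proof
      assume P: "P \<in> pline l"
      then have "P \<in> ppoints"
        by (simp add: pline_def)
      then obtain z where z: "z \<noteq> (0, 0, 0)" "P = pclass z"
        by (rule ppointsE)
      obtain s x y where sxy: "z = lincomb v u w (s, x, y)"
        using coords by blast
      have eq: "x * dot l u + y * dot l w = 0"
        using P l by (simp add: z sxy dot_lincomb)
      have nz: "(s, x, y) \<noteq> (0, 0, 0)"
        using z sxy by auto
      have ab: "dot l u \<noteq> 0 \<or> dot l w \<noteq> 0"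
        using dot_eq_0_imp[OF det] l by blast
      show "P \<in> line (dot l u) (dot l w)"
      proof (cases "x = 0 \<and> y = 0")
        case True
        then have "P = pclass v"
          unfolding pclass_v z(2) sxy pclass_eq using nz by (intro exI[of _ "1 / s"]) auto
        then show ?thesis
          by (simp add: line_def)
      next
        case False
        obtain k where k: "k \<noteq> 0" "dot l w = k * x" "- dot l u = k * y"
        proof (cases "x = 0")
          case True
          with eq False ab have "dot l w = 0" "y \<noteq> 0" by auto
          with True ab show thesis by (intro that[of "- dot l u / y"]) auto
        next
          case x: False
          have "dot l u = - (y * dot l w) / x"
            using eq x by (simp add: field_simps eq_neg_iff_add_eq_0)
          with x ab show thesis by (intro that[of "dot l w / x"]) (auto simp: field_simps)
        qed
        have "P = pclass (lincomb v u w (k * s, dot l w, - dot l u))"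
          unfolding z(2) sxy pclass_eq using k by (intro exI[of _ k]) auto
        then show ?thesis
          by (simp add: line_def)
      qed
    next
      assume "P \<in> line (dot l u) (dot l w)"
      moreover have "dot l u \<noteq> 0 \<or> dot l w \<noteq> 0"
        using dot_eq_0_imp[OF det] l by blast
      ultimately show "P \<in> pline l"
        using v l by (auto simp: line_def dot_lincomb lincomb_eq_0)
    qed
  qed
  have lines: "{L \<in> plines. pclass v \<in> L} = {line \<alpha> \<beta> | \<alpha> \<beta>. \<alpha> \<noteq> 0 \<or> \<beta> \<noteq> 0}"
  proof (intro Set.set_eqI iffI)
    fix L :: "'k vec3 set set"
    assume L: "L \<in> {L \<in> plines. pclass v \<in> L}"
    then obtain l where "l \<in> UNIV - {(0, 0, 0)}" "L = pline l"
      unfolding plines_def by blast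
    then have l: "l \<noteq> (0, 0, 0)" "L = pline l" "dot l v = 0"
      using L by simp_all
    then show "L \<in> {line \<alpha> \<beta> | \<alpha> \<beta>. \<alpha> \<noteq> 0 \<or> \<beta> \<noteq> 0}"
      using pline_eq[of l] dot_eq_0_imp[OF det, of l] by blast
  next
    fix L :: "'k vec3 set set"
    assume "L \<in> {line \<alpha> \<beta> | \<alpha> \<beta>. \<alpha> \<noteq> 0 \<or> \<beta> \<noteq> 0}"
    then obtain \<alpha> \<beta> where L: "L = line \<alpha> \<beta>" "\<alpha> \<noteq> 0 \<or> \<beta> \<noteq> 0"
      by blast
    obtain l where l: "dot l v = 0" "dot l u = \<alpha>" "dot l w = \<beta>"
      using dot_prescribed[OF det] by metis
    then have "l \<noteq> (0, 0, 0)"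
      using L by (auto simp: dot_def)
    then have "L = pline l"
      using l L pline_eq[of l] by simp
    moreover have "pline l \<in> plines"
      unfolding plines_def using \<open>l \<noteq> (0, 0, 0)\<close> by blast
    ultimately show "L \<in> {L \<in> plines. pclass v \<in> L}"
      using l v by simp
  qed
  have scale: "line (k * \<alpha>) (k * \<beta>) = line \<alpha> \<beta>" if k: "k \<noteq> 0" for k \<alpha> \<beta>
  proof -
    have "range ((*) k) = UNIV"
      using k by (intro surjI[of _ "\<lambda>x. x / k"]) simp
    then have "range (\<lambda>s. pclass (lincomb v u w (s, k * \<beta>, - (k * \<alpha>))))
        = range (\<lambda>s. pclass (lincomb v u w (k * s, k * \<beta>, - (k * \<alpha>))))"
      by (metis (no_types, lifting) image_cong image_image)
    also have "\<dots> = range (\<lambda>s. pclass (lincomb v u w (s, \<beta>, - \<alpha>)))"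
    proof (intro image_cong refl)
      fix s
      show "pclass (lincomb v u w (k * s, k * \<beta>, - (k * \<alpha>))) = pclass (lincomb v u w (s, \<beta>, - \<alpha>))"
        using k by (subst eq_commute, unfold pclass_eq) auto
    qed
    finally show ?thesis
      by (simp add: line_def)
  qed
  have card_line: "int (card (line \<alpha> \<beta> \<inter> conic Q)) = 1 + chi (D \<beta> (- \<alpha>))" if ab: "\<alpha> \<noteq> 0 \<or> \<beta> \<noteq> 0" for \<alpha> \<beta>
  proof -
    let ?g = "\<lambda>s. pclass (lincomb v u w (s, \<beta>, - \<alpha>))"
    have "line \<alpha> \<beta> \<inter> conic Q = ?g ` {s. qeval Q (lincomb v u w (s, \<beta>, - \<alpha>)) = 0}"
      using False ab by (auto simp: line_def lincomb_eq_0)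
    moreover have "inj ?g"
      using ab by (auto intro!: injI simp: pclass_eq)
    ultimately have "card (line \<alpha> \<beta> \<inter> conic Q) = card {s. qeval Q (lincomb v u w (s, \<beta>, - \<alpha>)) = 0}"
      by (simp add: card_image inj_on_subset)
    then show ?thesis
      using False card_quadratic_roots[of A] unfolding qeval D_def A by simp
  qed
  have tangents: "{L. tangent Q L \<and> pclass v \<in> L} = {line \<alpha> \<beta> | \<alpha> \<beta>. (\<alpha> \<noteq> 0 \<or> \<beta> \<noteq> 0) \<and> D \<beta> (- \<alpha>) = 0}"
  proof -
    have tangent_iff: "card (line \<alpha> \<beta> \<inter> conic Q) = 1 \<longleftrightarrow> D \<beta> (- \<alpha>) = 0" if "\<alpha> \<noteq> 0 \<or> \<beta> \<noteq> 0" for \<alpha> \<beta>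
      using card_line[OF that] by (metis add_cancel_right_right chi_eq_0_iff of_nat_1 of_nat_eq_iff)
    have "{L. tangent Q L \<and> pclass v \<in> L} = {L \<in> {L \<in> plines. pclass v \<in> L}. card (L \<inter> conic Q) = 1}"
      by (auto simp: tangent_def)
    also have "\<dots> = {line \<alpha> \<beta> | \<alpha> \<beta>. (\<alpha> \<noteq> 0 \<or> \<beta> \<noteq> 0) \<and> D \<beta> (- \<alpha>) = 0}"
      unfolding lines using tangent_iff by blast
    finally show ?thesis .
  qed
  have D_scale: "D (k * x) (k * y) = k ^ 2 * D x y" for k x y
    by (simp add: D_def power2_eq_square algebra_simps)
  let ?S = "{\<beta>. D \<beta> (- 1) = 0}"
  \<comment> \<open>A line determines its pair only up to scaling, so either
    \<open>\<alpha> = 1\<close> or the pair is \<open>(0, 1)\<close>.\<close>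
  have norm: "{line \<alpha> \<beta> | \<alpha> \<beta>. (\<alpha> \<noteq> 0 \<or> \<beta> \<noteq> 0) \<and> D \<beta> (- \<alpha>) = 0} =
      line 1 ` ?S \<union> (if D 1 0 = 0 then {line 0 1} else {})" (is "?T = ?T'")
  proof (intro equalityI subsetI)
    fix L assume "L \<in> ?T"
    then obtain \<alpha> \<beta> where L: "L = line \<alpha> \<beta>" "\<alpha> \<noteq> 0 \<or> \<beta> \<noteq> 0" "D \<beta> (- \<alpha>) = 0"
      by blast
    show "L \<in> ?T'"
    proof (cases "\<alpha> = 0")
      case True
      then show ?thesis
        using L scale[of \<beta> 0 1] D_scale[of \<beta> 1 0] by auto
    next
      case False
      then show ?thesis
        using L scale[of \<alpha> 1 "\<beta> / \<alpha>"] D_scale[of \<alpha> "\<beta> / \<alpha>" "- 1"] by auto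
    qed
  next
    fix L assume "L \<in> ?T'"
    then consider \<beta> where "L = line 1 \<beta>" "D \<beta> (- 1) = 0" | "L = line 0 1" "D 1 0 = 0"
      by (auto split: if_splits)
    then show "L \<in> ?T"
    proof cases
      case 1
      then show ?thesis
        using one_neq_zero by blast
    next
      case 2
      then have "L = line 0 1 \<and> (0 \<noteq> (0::'k) \<or> 1 \<noteq> (0::'k)) \<and> D 1 (- 0) = 0"
        by simp
      then show ?thesis
        by blast
    qed
  qed
  have inj: "inj (line 1)"
  proof (rule injI)
    fix \<beta> \<beta>' assume "line 1 \<beta> = line 1 \<beta>'"
    then have "pclass (lincomb v u w (0, \<beta>, - 1)) \<in> line 1 \<beta>'"
      by (auto simp: line_def)
    then show "\<beta> = \<beta>'"
      unfolding line_def pclass_v by (auto simp: pclass_eq simp del: lincomb_1)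
  qed
  have ne: "line 0 1 \<notin> range (line 1)"
  proof
    assume "line 0 1 \<in> range (line 1)"
    then obtain \<beta> where "line 0 1 = line 1 \<beta>"
      by blast
    then have "pclass (lincomb v u w (0, 1, 0)) \<in> line 1 \<beta>"
      by (auto simp: line_def)
    then show False
      unfolding line_def pclass_v by (auto simp: pclass_eq simp del: lincomb_1)
  qed
  have disc: "(2 * d * e - 4 * A * f) ^ 2 - 4 * (d ^ 2 - 4 * A * b) * (e ^ 2 - 4 * A * c)
      = (4 * det3 v u w) ^ 2 * (qdisc Q * qeval Q v)"
  proof -
    have "(2 * d * e - 4 * A * f) ^ 2 - 4 * (d ^ 2 - 4 * A * b) * (e ^ 2 - 4 * A * c)
        = 16 * A * qdisc (qchange v u w Q)"
      unfolding Q' qdisc.simps by Groebner_Basis.algebra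
    also have "\<dots> = (4 * det3 v u w) ^ 2 * (qdisc Q * qeval Q v)"
      unfolding qdisc_qchange A by Groebner_Basis.algebra
    finally show ?thesis .
  qed
  have chi_disc: "chi ((2 * d * e - 4 * A * f) ^ 2 - 4 * (d ^ 2 - 4 * A * b) * (e ^ 2 - 4 * A * c))
      = chi (qdisc Q * qeval Q v)"
  proof -
    have "4 * det3 v u w \<noteq> 0"
      using det four_nonzero by simp
    then have "chi ((4 * det3 v u w) ^ 2) = 1"
      by (rule chi_square)
    then show ?thesis
      unfolding disc chi_mult[of "(4 * det3 v u w) ^ 2"] by simp
  qed
  let ?R = "{x. (d ^ 2 - 4 * A * b) * x ^ 2 + (2 * d * e - 4 * A * f) * x + (e ^ 2 - 4 * A * c) = 0}"
  \<comment> \<open>\<open>D\<close> is even, so evaluating it at \<open>(- x, - 1)\<close> is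
    evaluating it at \<open>(x, 1)\<close>; this accounts for the sign.\<close>
  have neg: "?S = uminus ` ?R"
  proof -
    have D: "D (- x) (- 1) = (d ^ 2 - 4 * A * b) * x ^ 2 + (2 * d * e - 4 * A * f) * x
        + (e ^ 2 - 4 * A * c)" for x
      unfolding D_def by Groebner_Basis.algebra
    have uminus_R: "{\<beta>. - \<beta> \<in> R} = uminus ` R" for R :: "'k set"
      by (auto intro: image_eqI[of _ uminus "- _"])
    have "\<beta> \<in> ?S \<longleftrightarrow> - \<beta> \<in> ?R" for \<beta>
      using D[of "- \<beta>"] by simp
    then have "?S = {\<beta>. - \<beta> \<in> ?R}"
      by blast
    also have "\<dots> = uminus ` ?R"
      by (rule uminus_R)
    finally show ?thesis .
  qed
  have D10: "D 1 0 = d ^ 2 - 4 * A * b"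
    by (simp add: D_def)
  have "int (card {L. tangent Q L \<and> pclass v \<in> L}) = 1 + chi (qdisc Q * qeval Q v)"
  proof (cases "D 1 0 = 0")
    case False
    then have "card {L. tangent Q L \<and> pclass v \<in> L} = card ?S"
      unfolding tangents norm by (simp add: card_image inj_on_subset[OF inj])
    then show ?thesis
      using False card_quadratic_roots unfolding D10 neg chi_disc[symmetric]
      by (simp add: card_image)
  next
    case True
    have ne0: "qdisc Q * qeval Q v \<noteq> 0"
      using Q \<open>qeval Q v \<noteq> 0\<close> by simp
    then have r: "2 * d * e - 4 * A * f \<noteq> 0"
      using True chi_disc unfolding D10 by auto
    have "{x. (d ^ 2 - 4 * A * b) * x ^ 2 + (2 * d * e - 4 * A * f) * x + (e ^ 2 - 4 * A * c) = 0}
        = {- (e ^ 2 - 4 * A * c) / (2 * d * e - 4 * A * f)}"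
      using True r unfolding D10 by (auto simp: field_simps eq_neg_iff_add_eq_0)
    then have "card ?S = 1"
      unfolding neg by simp
    moreover have "line 0 1 \<notin> line 1 ` ?S" "card (line 1 ` ?S) = card ?S"
      using ne by (auto simp: card_image inj_on_subset[OF inj])
    then have "card {L. tangent Q L \<and> pclass v \<in> L} = Suc (card ?S)"
      using True unfolding tangents norm by simp
    moreover have "chi (qdisc Q * qeval Q v) = 1"
      using True r unfolding chi_disc[symmetric] D10 by simp
    ultimately show ?thesis
      by simp
  qed
  then show ?thesis
    using v False by (auto simp: external_def)
qed

section \<open>Character sums of conics through a rational point\<close>

text \<open>With \<open>u = conj w / w\<close>, membership of \<open>g w\<close> in \<open>K\<close> is a cubic equation for \<open>u\<close> with leading
  coefficient \<open>C\<close> and constant term \<open>- conj C\<close>. If two distinct roots come from \<open>w1\<close> and \<open>w2\<close>, then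
  by Vieta the third one comes from \<open>C / (w1 * w2)\<close>, which forces the product of the three signs
  to be \<open>1\<close>.\<close>
lemma norm_cubic_roots:
  fixes A B C :: 'k
  assumes C: "C \<noteq> 0"
  defines "W \<equiv> {w. w \<noteq> 0 \<and> (A * w ^ 2 + B * w * conj w + C * conj w ^ 2) / w \<in> K}"
  shows "\<exists>(n, t) \<in> {(0, 0), (1, 1), (1, -1), (2, 0), (2, 2), (3, 3), (3, -1)}.
      int (card W) = (int q - 1) * n \<and> (\<Sum>w\<in>W. chi (C * w)) = (int q - 1) * t"
proof -
  \<comment> \<open>This is \<open>w ^ (q - 1)\<close>, which determines \<open>w\<close> up to a
    factor in \<open>K\<close>.\<close>
  define r where "r w = conj w / w" for w
  define R T where "R = B - conj A" and "T = A - conj B"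
  define P where "P u = C * u ^ 3 + R * u ^ 2 + T * u - conj C" for u
  have W_iff: "w \<in> W \<longleftrightarrow> P (r w) = 0" if w: "w \<noteq> 0" for w
  proof -
    let ?v = "conj w"
    have v: "?v \<noteq> 0"
      using w by simp
    have "w \<in> W \<longleftrightarrow> (conj A * ?v ^ 2 + conj B * ?v * w + conj C * w ^ 2) / ?v
        = (A * w ^ 2 + B * w * ?v + C * ?v ^ 2) / w"
      using w by (simp add: W_def K_iff)
    also have "\<dots> \<longleftrightarrow> w * (conj A * ?v ^ 2 + conj B * ?v * w + conj C * w ^ 2)
        = ?v * (A * w ^ 2 + B * w * ?v + C * ?v ^ 2)"
      using w v by (simp add: frac_eq_eq mult.commute)
    also have "\<dots> \<longleftrightarrow> C * ?v ^ 3 + R * ?v ^ 2 * w + T * ?v * w ^ 2 - conj C * w ^ 3 = 0"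
      unfolding R_def T_def by Groebner_Basis.algebra
    also have "C * ?v ^ 3 + R * ?v ^ 2 * w + T * ?v * w ^ 2 - conj C * w ^ 3 = w ^ 3 * P (r w)"
      using w by (simp add: P_def r_def field_simps power3_eq_cube power2_eq_square)
    finally show ?thesis
      using w by simp
  qed
  have W_nonzero: "w \<noteq> 0" if "w \<in> W" for w
    using that by (simp add: W_def)
  have r_eq_iff: "r w = r w' \<longleftrightarrow> w' / w \<in> K" if "w \<noteq> 0" "w' \<noteq> 0" for w w'
    using that by (auto simp: r_def K_iff field_simps)
  \<comment> \<open>Factors in \<open>K\<close> are squares, so the sign of \<open>C * w\<close>
    depends only on \<open>r w\<close> and any preimage may be chosen.\<close>
  define \<psi> where "\<psi> u = chi (C * inv_into W r u)" for u
  have chi_r: "chi (C * w) = chi (C * w')" if "r w = r w'" "w \<noteq> 0" "w' \<noteq> 0" for w w'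
  proof -
    have "C * w' = (w' / w) * (C * w)"
      using that by simp
    also have "chi \<dots> = chi (C * w)"
    proof -
      have "chi (w' / w) = 1"
        using that r_eq_iff[of w w'] by simp
      then show ?thesis
        by (simp only: chi_mult[of "w' / w"] mult_1)
    qed
    finally show ?thesis
      by simp
  qed
  have \<psi>: "\<psi> (r w) = chi (C * w)" if w: "w \<in> W" for w
  proof -
    let ?w = "inv_into W r (r w)"
    have "?w \<in> W" "r ?w = r w"
      using w by (auto intro: inv_into_into f_inv_into_f)
    then show ?thesis
      unfolding \<psi>_def using w W_nonzero by (intro chi_r) auto
  qed
  have fibre: "card {w \<in> W. r w = u} = q - 1" if u: "u \<in> r ` W" for u
  proof -
    obtain w0 where w0: "w0 \<in> W" "u = r w0"
      using u by blast
    have nz: "w0 \<noteq> 0"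
      using w0 W_nonzero by blast
    have "{w \<in> W. r w = u} = (\<lambda>k. k * w0) ` (K - {0})"
    proof (intro equalityI subsetI)
      fix w assume w: "w \<in> {w \<in> W. r w = u}"
      then have "w \<noteq> 0"
        using W_nonzero by blast
      then have "w / w0 \<in> K - {0}"
        using w w0 nz r_eq_iff[of w0 w] by simp
      moreover have "w = w / w0 * w0"
        using nz by simp
      ultimately show "w \<in> (\<lambda>k. k * w0) ` (K - {0})"
        by blast
    next
      fix w assume "w \<in> (\<lambda>k. k * w0) ` (K - {0})"
      then obtain k where k: "k \<in> K" "k \<noteq> 0" "w = k * w0"
        by blast
      then have "r w = r w0"
        using r_eq_iff[of w0 w] nz by simp
      then show "w \<in> {w \<in> W. r w = u}"
        using W_iff[of w] W_iff[of w0] w0 k nz by simp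
    qed
    then have "card {w \<in> W. r w = u} = card (K - {0})"
      using nz by (simp add: card_image inj_on_def)
    then show ?thesis
      using card_Diff_singleton[of 0 K] by (simp add: card_K)
  qed
  define U where "U = r ` W"
  have card_W: "int (card W) = (int q - 1) * int (card U)"
    using card_eq_sum_fibres[of W r] fibre q_ge_3 by (simp add: U_def of_nat_diff)
  have "(\<Sum>w\<in>W. chi (C * w)) = (\<Sum>u\<in>U. \<Sum>w | w \<in> W \<and> r w = u. chi (C * w))"
    unfolding U_def by (rule sum.image_gen) simp
  also have "\<dots> = (\<Sum>u\<in>U. \<Sum>w | w \<in> W \<and> r w = u. \<psi> u)"
    by (intro sum.cong refl) (auto simp: \<psi>)
  also have "\<dots> = (int q - 1) * (\<Sum>u\<in>U. \<psi> u)"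
    using fibre q_ge_3 by (simp add: U_def of_nat_diff sum_distrib_left)
  finally have sum_W: "(\<Sum>w\<in>W. chi (C * w)) = (int q - 1) * (\<Sum>u\<in>U. \<psi> u)" .
  have \<psi>_cases: "\<psi> u = 1 \<or> \<psi> u = -1" if "u \<in> U" for u
    using that \<psi> chi_nonzero_cases C W_nonzero unfolding U_def by (metis imageE mult_eq_0_iff)
  have "(card U, \<Sum>u\<in>U. \<psi> u) \<in> {(0, 0), (1, 1), (1, -1), (2, 0), (2, 2), (3, 3), (3, -1)}"
  proof (cases "\<exists>u1 u2. u1 \<in> U \<and> u2 \<in> U \<and> u1 \<noteq> u2")
    case True
    then obtain w1 w2 where w: "w1 \<in> W" "w2 \<in> W" "r w1 \<noteq> r w2"
      by (auto simp: U_def)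
    \<comment> \<open>The third root is read off from the sum of the roots; it may coincide with
      \<open>u1\<close> or \<open>u2\<close>.\<close>
    define u1 u2 u3 where u: "u1 = r w1" "u2 = r w2" "u3 = - R / C - u1 - u2"
    have nz: "w1 \<noteq> 0" "w2 \<noteq> 0" "u1 \<noteq> 0" "u2 \<noteq> 0"
      using w W_nonzero by (auto simp: u r_def)
    have roots: "P u1 = 0" "P u2 = 0" "u1 \<noteq> u2"
      using w W_iff nz by (auto simp: u)
    have R: "R = - C * (u1 + u2 + u3)"
      using C by (simp add: u(3) field_simps)
    have T: "T = C * (u1 * u2 + u1 * u3 + u2 * u3)"
    proof -
      have "(u1 - u2) * (T - C * (u1 * u2 + u1 * u3 + u2 * u3)) = P u1 - P u2"
        unfolding P_def R by Groebner_Basis.algebra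
      then show ?thesis
        using roots by simp
    qed
    have prod: "conj C = C * u1 * u2 * u3"
      using roots(1) unfolding P_def R T by Groebner_Basis.algebra
    have P_eq: "P u = C * ((u - u1) * (u - u2) * (u - u3))" for u
      unfolding P_def R T prod by Groebner_Basis.algebra
    define w3 where "w3 = C / (w1 * w2)"
    have "w3 \<noteq> 0"
      using C nz by (simp add: w3_def)
    have "r w3 = u3"
      using prod C nz unfolding w3_def u(1,2) r_def by (simp add: field_simps)
    have "w3 \<in> W"
      using W_iff[OF \<open>w3 \<noteq> 0\<close>] by (simp add: \<open>r w3 = u3\<close> P_eq)
    have U: "U = {u1, u2, u3}"
    proof (intro equalityI subsetI)
      fix x assume "x \<in> U"
      then have "P x = 0"
        using W_iff W_nonzero by (auto simp: U_def)
      then show "x \<in> {u1, u2, u3}"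
        using C by (simp add: P_eq)
    next
      fix x assume "x \<in> {u1, u2, u3}"
      then show "x \<in> U"
        using w \<open>w3 \<in> W\<close> unfolding U_def u(1,2) \<open>r w3 = u3\<close>[symmetric] by blast
    qed
    have "\<psi> u1 * \<psi> u2 * \<psi> u3 = chi (C * w1) * chi (C * w2) * chi (C * w3)"
      using \<psi> w \<open>w3 \<in> W\<close> \<open>r w3 = u3\<close> unfolding u(1,2) by metis
    also have "\<dots> = chi ((C ^ 2) ^ 2)"
      using nz unfolding chi_mult[symmetric] w3_def by (simp add: power2_eq_square mult.assoc)
    also have "\<dots> = 1"
      using C by (intro chi_square) simp
    finally have "\<psi> u1 * \<psi> u2 * \<psi> u3 = 1" .
    note prod_1 = this
    have signs: "\<psi> u1 = 1 \<or> \<psi> u1 = -1" "\<psi> u2 = 1 \<or> \<psi> u2 = -1" "\<psi> u3 = 1 \<or> \<psi> u3 = -1"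
      using \<psi>_cases by (auto simp: U)
    \<comment> \<open>At a double root the repeated sign squares to \<open>1\<close>, so the simple
      root has sign \<open>1\<close>; this rules out the pair \<open>(2, -2)\<close>. For three
      distinct roots, product \<open>1\<close> leaves the sums \<open>3\<close> and
      \<open>-1\<close>.\<close>
    consider "u3 = u1" | "u3 = u2" | "u3 \<noteq> u1" "u3 \<noteq> u2"
      by blast
    then show ?thesis
    proof cases
      case 1
      then have "U = {u1, u2}" "\<psi> u2 = 1"
        using U prod_1 signs by auto
      then show ?thesis
        using roots(3) signs by auto
    next
      case 2
      then have "U = {u1, u2}" "\<psi> u1 = 1"
        using U prod_1 signs by auto
      then show ?thesis
        using roots(3) signs by auto
    next
      case 3
      then have "card U = 3" "(\<Sum>u\<in>U. \<psi> u) = \<psi> u1 + \<psi> u2 + \<psi> u3"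
        using U roots(3) by auto
      then show ?thesis
        using prod_1 signs by auto
    qed
  next
    case False
    then consider "U = {}" | u where "U = {u}"
      by blast
    then show ?thesis
      using \<psi>_cases by cases auto
  qed
  then have "(int (card U), \<Sum>u\<in>U. \<psi> u) \<in> {(0, 0), (1, 1), (1, -1), (2, 0), (2, 2), (3, 3), (3, -1)}"
    by auto
  then show ?thesis
    by (rule bexI[rotated]) (simp only: prod.case card_W sum_W)
qed

text \<open>For \<open>y, z \<in> K\<close> both variables are linear in \<open>w = d y + e z\<close> and \<open>conj w\<close>, and in these
  coordinates the coefficient \<open>C\<close> of \<open>conj w ^ 2\<close> equals \<open>qdisc\<close> up to a square.\<close>
lemma counts_independent:
  fixes b c d e f :: 'k
  assumes disc: "qdisc (0, b, c, d, e, f) \<noteq> 0"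
    and indep: "\<And>y z. y \<in> K \<Longrightarrow> z \<in> K \<Longrightarrow> d * y + e * z = 0 \<Longrightarrow> y = 0 \<and> z = 0"
  shows "\<exists>(n, t) \<in> {(0, 0), (1, 1), (1, -1), (2, 0), (2, 2), (3, 3), (3, -1)}.
      int (card {v \<in> K \<times> K \<times> K. qeval (0, b, c, d, e, f) v = 0}) = int q + (int q - 1) * n \<and>
      (\<Sum>v \<in> K \<times> K \<times> K. chi (qdisc (0, b, c, d, e, f) * qeval (0, b, c, d, e, f) v))
          = (int q - 1) * int q * t"
proof -
  define \<delta> where "\<delta> = qdisc (0, b, c, d, e, f)"
  have \<delta>: "\<delta> = b * e ^ 2 + c * d ^ 2 - d * e * f" "\<delta> \<noteq> 0"
    using disc by (simp_all add: \<delta>_def power2_eq_square)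
  \<comment> \<open>The determinant of the linear system expressing \<open>w\<close> and
    \<open>conj w\<close> in terms of \<open>y\<close> and \<open>z\<close>. It vanishes only if
    \<open>e = 0\<close> or \<open>d / e\<close> lies in \<open>K\<close>.\<close>
  define \<eta> where "\<eta> = d * conj e - conj d * e"
  have \<eta>: "\<eta> \<noteq> 0"
  proof
    assume 0: "\<eta> = 0"
    show False
    proof (cases "e = 0")
      case True
      then show False
        using indep[of 0 1] by simp
    next
      case False
      then have "d / e \<in> K"
        using 0 by (simp add: K_iff \<eta>_def field_simps)
      then show False
        using indep[of 1 "- (d / e)"] False by simp
    qed
  qed
  \<comment> \<open>By Cramer, \<open>\<eta> y = conj e * w - e * conj w\<close> and
    \<open>\<eta> z = d * conj w - conj d * w\<close>; substitution into
    \<open>b y^2 + c z^2 + f y z\<close> gives these coefficients.\<close>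
  define A B C where
    "A = (b * conj e ^ 2 + c * conj d ^ 2 - f * conj d * conj e) / \<eta> ^ 2"
    "B = (f * (conj e * d + e * conj d) - 2 * b * e * conj e - 2 * c * d * conj d) / \<eta> ^ 2"
    "C = \<delta> / \<eta> ^ 2"
  have C: "C \<noteq> 0"
    using \<delta> \<eta> by (simp add: A_B_C_def)
  have \<delta>_C: "\<delta> = \<eta> ^ 2 * C"
    using \<eta> by (simp add: A_B_C_def)
  define G where "G w = A * w ^ 2 + B * w * conj w + C * conj w ^ 2" for w
  define h where "h = (\<lambda>(y, z). d * y + e * z)"
  have qeval: "qeval (0, b, c, d, e, f) (x, p) = x * h p + G (h p)" if p: "p \<in> K \<times> K" for x p
  proof -
    obtain y z where yz: "p = (y, z)" "y \<in> K" "z \<in> K"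
      using p by blast
    have w: "h p = d * y + e * z" "conj (h p) = conj d * y + conj e * z"
      using yz by (simp_all add: h_def K_iff)
    have "\<eta> ^ 2 * G (h p) = \<eta> ^ 2 * (b * y ^ 2 + c * z ^ 2 + f * y * z)"
    proof -
      have coeffs: "\<eta> ^ 2 * A = b * conj e ^ 2 + c * conj d ^ 2 - f * conj d * conj e"
        "\<eta> ^ 2 * B = f * (conj e * d + e * conj d) - 2 * b * e * conj e - 2 * c * d * conj d"
        "\<eta> ^ 2 * C = \<delta>"
        using \<eta> by (simp_all add: A_B_C_def)
      have "\<eta> ^ 2 * G (h p) = (\<eta> ^ 2 * A) * h p ^ 2 + (\<eta> ^ 2 * B) * h p * conj (h p)
          + (\<eta> ^ 2 * C) * conj (h p) ^ 2"
        unfolding G_def by Groebner_Basis.algebra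
      also have "\<dots> = \<eta> ^ 2 * (b * y ^ 2 + c * z ^ 2 + f * y * z)"
        unfolding coeffs w(2) unfolding w(1) \<delta>(1) \<eta>_def by Groebner_Basis.algebra
      finally show ?thesis .
    qed
    then have "G (h p) = b * y ^ 2 + c * z ^ 2 + f * y * z"
      using \<eta> by simp
    then show ?thesis
      using w(1) by (simp add: yz power2_eq_square algebra_simps)
  qed
  have inj: "inj_on h (K \<times> K)"
  proof (rule inj_onI)
    fix p p' assume *: "p \<in> K \<times> K" "p' \<in> K \<times> K" "h p = h p'"
    then have "d * (fst p - fst p') + e * (snd p - snd p') = 0"
      by (auto simp: h_def algebra_simps)
    then show "p = p'"
      using indep[of "fst p - fst p'" "snd p - snd p'"] * by (auto simp: prod_eq_iff)
  qed
  have surj: "h ` (K \<times> K) = UNIV"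
    using inj by (intro card_subset_eq)
      (auto simp: card_image card_cartesian_product card_K card_UNIV power2_eq_square)
  define W where "W = {w. w \<noteq> 0 \<and> G w / w \<in> K}"
  \<comment> \<open>The term \<open>- chi (\<delta> * w)\<close> is separated for every
    \<open>w\<close>, not only outside \<open>W\<close>, because it sums to zero over the whole
    field.\<close>
  have sum_x: "(\<Sum>x\<in>K. chi (\<delta> * (x * w + G w)))
      = (if w \<in> W then int q * chi (C * w) else 0) - chi (\<delta> * w)" for w
  proof (cases "w = 0")
    case False
    have "(\<Sum>x\<in>K. chi (\<delta> * (x * w + G w))) = (\<Sum>x\<in>K. chi (\<delta> * w) * chi (x + G w / w))"
    proof (intro sum.cong refl)
      fix x
      have "\<delta> * (x * w + G w) = (\<delta> * w) * (x + G w / w)"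
        using False by (simp add: field_simps)
      then show "chi (\<delta> * (x * w + G w)) = chi (\<delta> * w) * chi (x + G w / w)"
        by (simp only: chi_mult)
    qed
    also have "\<dots> = chi (\<delta> * w) * (if G w / w \<in> K then int q - 1 else - 1)"
      by (simp add: sum_chi_shift flip: sum_distrib_left)
    also have "chi (\<delta> * w) = chi (C * w)"
      using \<eta> by (simp add: \<delta>_C chi_mult)
    finally show ?thesis
      using False \<eta> by (simp add: W_def \<delta>_C chi_mult algebra_simps)
  qed (simp add: W_def G_def)
  \<comment> \<open>The value \<open>w = 0\<close> stands for \<open>y = z = 0\<close>, where every
    \<open>x\<close> gives a zero.\<close>
  have card_x: "card {x \<in> K. x * w + G w = 0} = (if w = 0 then q else if w \<in> W then 1 else 0)" for w
  proof (cases "w = 0")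
    case False
    have "{x \<in> K. x * w + G w = 0} = (if G w / w \<in> K then {- (G w / w)} else {})"
    proof -
      have "x * w + G w = 0 \<longleftrightarrow> x = - (G w / w)" for x
        using False by (simp add: field_simps eq_neg_iff_add_eq_0)
      moreover have "- (G w / w) \<in> K \<longleftrightarrow> G w / w \<in> K"
        using K_closed(7) by (metis minus_minus)
      ultimately show ?thesis
        by auto
    qed
    then show ?thesis
      using False by (simp add: W_def)
  qed (simp add: G_def card_K)
  have "(\<Sum>v \<in> K \<times> K \<times> K. chi (\<delta> * qeval (0, b, c, d, e, f) v))
      = (\<Sum>x\<in>K. \<Sum>p\<in>K \<times> K. chi (\<delta> * qeval (0, b, c, d, e, f) (x, p)))"
    by (simp add: sum.cartesian_product split_def)
  also have "\<dots> = (\<Sum>p\<in>K \<times> K. \<Sum>x\<in>K. chi (\<delta> * qeval (0, b, c, d, e, f) (x, p)))"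
    by (rule sum.swap)
  also have "\<dots> = (\<Sum>p\<in>K \<times> K. \<Sum>x\<in>K. chi (\<delta> * (x * h p + G (h p))))"
    by (intro sum.cong refl) (simp only: qeval)
  also have "\<dots> = (\<Sum>w\<in>UNIV. \<Sum>x\<in>K. chi (\<delta> * (x * w + G w)))"
    using sum.reindex[OF inj, of "\<lambda>w. \<Sum>x\<in>K. chi (\<delta> * (x * w + G w))"] by (simp add: surj)
  also have "\<dots> = int q * (\<Sum>w\<in>W. chi (C * w)) - (\<Sum>w\<in>UNIV. chi (\<delta> * w))"
    by (simp add: sum_x sum_subtractf sum.If_cases sum_distrib_left)
  also have "(\<Sum>w\<in>UNIV. chi (\<delta> * w)) = 0"
    by (simp add: chi_mult sum_chi_UNIV flip: sum_distrib_left)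
  finally have S: "(\<Sum>v \<in> K \<times> K \<times> K. chi (\<delta> * qeval (0, b, c, d, e, f) v)) = int q * (\<Sum>w\<in>W. chi (C * w))"
    by simp
  have "card {v \<in> K \<times> K \<times> K. qeval (0, b, c, d, e, f) v = 0}
      = (\<Sum>v \<in> K \<times> K \<times> K. if qeval (0, b, c, d, e, f) v = 0 then 1 else 0)"
    by (simp add: sum.If_cases Int_def)
  also have "\<dots> = (\<Sum>x\<in>K. \<Sum>p\<in>K \<times> K. if qeval (0, b, c, d, e, f) (x, p) = 0 then 1 else 0)"
    by (simp add: sum.cartesian_product split_def)
  also have "\<dots> = (\<Sum>p\<in>K \<times> K. \<Sum>x\<in>K. if qeval (0, b, c, d, e, f) (x, p) = 0 then 1 else 0)"
    by (rule sum.swap)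
  also have "\<dots> = (\<Sum>p\<in>K \<times> K. card {x \<in> K. x * h p + G (h p) = 0})"
    by (intro sum.cong refl) (simp only: qeval, simp add: sum.If_cases Int_def)
  also have "\<dots> = (\<Sum>w\<in>UNIV. card {x \<in> K. x * w + G w = 0})"
    using sum.reindex[OF inj, of "\<lambda>w. card {x \<in> K. x * w + G w = 0}"] by (simp add: surj)
  also have "\<dots> = q + (\<Sum>w\<in>UNIV - {0}. if w \<in> W then 1 else 0)"
    unfolding card_x by (subst sum.remove[of _ 0]) (auto intro!: sum.cong)
  also have "(\<Sum>w\<in>UNIV - {0}. if w \<in> W then 1 else 0) = card W"
    by (simp add: sum.If_cases W_def Int_def)
  finally have N: "card {v \<in> K \<times> K \<times> K. qeval (0, b, c, d, e, f) v = 0} = q + card W" .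
  obtain n t where nt: "(n, t) \<in> {(0, 0), (1, 1), (1, -1), (2, 0), (2, 2), (3, 3), (3, -1)}"
    "int (card W) = (int q - 1) * n" "(\<Sum>w\<in>W. chi (C * w)) = (int q - 1) * t"
    using norm_cubic_roots[OF C, of A B] unfolding W_def G_def by blast
  show ?thesis
    unfolding \<delta>_def[symmetric] S N using nt(2,3) by (intro bexI[OF _ nt(1)]) simp
qed

text \<open>Subtracting the conjugate equation leaves a polynomial of degree at most two in
  \<open>y\<close>, nonzero because some coefficient is outside \<open>K\<close>.\<close>

lemma card_quadratic_in_K_le:
  fixes b f c :: 'k
  assumes "\<not> {b, f, c} \<subseteq> K"
  shows "card {y \<in> K. b * y ^ 2 + f * y + c \<in> K} \<le> 2"
proof -
  let ?p = "[:c - conj c, f - conj f, b - conj b:]"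
  have "?p \<noteq> 0"
    using assms by (auto simp: K_iff)
  have "card {y \<in> K. b * y ^ 2 + f * y + c \<in> K} \<le> card {y. poly ?p y = 0}"
  proof (intro card_mono poly_roots_finite \<open>?p \<noteq> 0\<close> subsetI)
    fix y assume "y \<in> {y \<in> K. b * y ^ 2 + f * y + c \<in> K}"
    then have y: "conj y = y" and "conj (b * y ^ 2 + f * y + c) = b * y ^ 2 + f * y + c"
      by (simp_all only: K_iff mem_Collect_eq)
    then have "conj b * y ^ 2 + conj f * y + conj c = b * y ^ 2 + f * y + c"
      by simp
    then show "y \<in> {y. poly ?p y = 0}"
      by (simp add: power2_eq_square algebra_simps)
  qed
  also have "\<dots> \<le> degree ?p"
    using \<open>?p \<noteq> 0\<close> by (rule card_poly_roots_bound)
  also have "\<dots> \<le> 2"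
    by simp
  finally show ?thesis .
qed

text \<open>The discriminant of this form is \<open>b\<close>, and \<open>z = 0\<close> is the
  tangent at the base point. There \<open>b * F\<close> is the square \<open>(b * y) ^ 2\<close>.
  For \<open>z \<noteq> 0\<close>, dehomogenising gives \<open>x + h y\<close>, which has a zero
  \<open>x\<close> in \<open>K\<close> exactly when \<open>h y\<close> lies in \<open>K\<close>;
  \<open>r\<close> counts these \<open>y\<close>.\<close>

lemma counts_normalised:
  fixes b f c :: 'k
  assumes b: "b \<noteq> 0"
  defines "F \<equiv> qeval (0, b, c, 0, 1, f)" and "r \<equiv> card {y \<in> K. b * y ^ 2 + f * y + c \<in> K}"
  shows "card {v \<in> K \<times> K \<times> K. F v = 0} = q + (q - 1) * r"
    and "(\<Sum>v \<in> K \<times> K \<times> K. chi (b * F v)) = (int q - 1) * int q * (1 + chi b * (int r - 1))"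
proof -
  define h where "h y = b * y ^ 2 + f * y + c" for y
  have F: "F (x, y, z) = x * z + b * y ^ 2 + f * y * z + c * z ^ 2" for x y z
    by (simp add: F_def power2_eq_square)
  have F_scale: "F (x * z, y * z, z) = z ^ 2 * (x + h y)" for x y z
    by (simp add: F h_def power2_eq_square algebra_simps)
  \<comment> \<open>Splits off \<open>z = 0\<close> and replaces \<open>x\<close>, \<open>y\<close>
    by \<open>x * z\<close>, \<open>y * z\<close> on the remaining vectors.\<close>
  have sum_K3: "(\<Sum>v \<in> K \<times> K \<times> K. g v) = (\<Sum>x\<in>K. \<Sum>y\<in>K. g (x, y, 0))
      + (\<Sum>z\<in>K - {0}. \<Sum>x\<in>K. \<Sum>y\<in>K. g (x * z, y * z, z))"
    for g :: "'k vec3 \<Rightarrow> int"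
  proof -
    have "(\<Sum>v \<in> K \<times> K \<times> K. g v) = (\<Sum>x\<in>K. \<Sum>y\<in>K. \<Sum>z\<in>K. g (x, y, z))"
      by (simp add: sum.cartesian_product split_def)
    also have "\<dots> = (\<Sum>x\<in>K. \<Sum>z\<in>K. \<Sum>y\<in>K. g (x, y, z))"
      by (intro sum.cong refl sum.swap)
    also have "\<dots> = (\<Sum>z\<in>K. \<Sum>x\<in>K. \<Sum>y\<in>K. g (x, y, z))"
      by (rule sum.swap)
    also have "\<dots> = (\<Sum>x\<in>K. \<Sum>y\<in>K. g (x, y, 0)) + (\<Sum>z\<in>K - {0}. \<Sum>x\<in>K. \<Sum>y\<in>K. g (x, y, z))"
      by (subst sum.remove[of _ 0]) auto
    also have "(\<Sum>z\<in>K - {0}. \<Sum>x\<in>K. \<Sum>y\<in>K. g (x, y, z)) = (\<Sum>z\<in>K - {0}. \<Sum>x\<in>K. \<Sum>y\<in>K. g (x * z, y * z, z))"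
    proof (rule sum.cong[OF refl])
      fix z assume z: "z \<in> K - {0}"
      have reindex: "(\<Sum>x\<in>K. k x) = (\<Sum>x\<in>K. k (x * z))" for k :: "'k \<Rightarrow> int"
        by (rule sum.reindex_bij_witness[of _ "\<lambda>x. x * z" "\<lambda>x. x / z"]) (use z in auto)
      have "(\<Sum>x\<in>K. \<Sum>y\<in>K. g (x, y, z)) = (\<Sum>x\<in>K. \<Sum>y\<in>K. g (x * z, y, z))"
        by (rule reindex)
      also have "\<dots> = (\<Sum>x\<in>K. \<Sum>y\<in>K. g (x * z, y * z, z))"
        by (intro sum.cong refl reindex)
      finally show "(\<Sum>x\<in>K. \<Sum>y\<in>K. g (x, y, z)) = (\<Sum>x\<in>K. \<Sum>y\<in>K. g (x * z, y * z, z))" .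
    qed
    finally show ?thesis .
  qed
  have card_K0: "card (K - {0}) = q - 1"
    using card_Diff_singleton[of 0 K] by (simp add: card_K)
  have sum_K0: "(\<Sum>z\<in>K - {0}. s) = (int q - 1) * s" for s
    unfolding sum_constant card_K0 using q_ge_3 by (simp add: of_nat_diff)
  have r: "r = card {y \<in> K. h y \<in> K}"
    by (simp add: r_def h_def)
  have sum_r: "(\<Sum>y\<in>K. if h y \<in> K then s else t) = int r * s + (int q - int r) * t" for s t
  proof -
    have "K \<inter> - {y. h y \<in> K} = K - {y \<in> K. h y \<in> K}"
      by blast
    then have "card (K \<inter> - {y. h y \<in> K}) = q - r"
      by (simp add: card_Diff_subset card_K r)
    moreover have "r \<le> q"
      unfolding r card_K[symmetric] by (intro card_mono) auto
    ultimately show ?thesis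
      by (simp add: sum.If_cases r Int_def of_nat_diff)
  qed
  have "int (card {v \<in> K \<times> K \<times> K. F v = 0}) = (\<Sum>v \<in> K \<times> K \<times> K. if F v = 0 then 1 else 0)"
    by (simp add: sum.If_cases Int_def)
  also have "\<dots> = (\<Sum>x\<in>K. \<Sum>y\<in>K. if F (x, y, 0) = 0 then 1 else 0) + (\<Sum>z\<in>K - {0}. \<Sum>x\<in>K. \<Sum>y\<in>K. if F (x * z, y * z, z) = 0 then 1 else 0)"
    by (rule sum_K3)
  also have "(\<Sum>x\<in>K. \<Sum>y\<in>K. if F (x, y, 0) = 0 then 1 else 0)
      = (\<Sum>x\<in>K. \<Sum>y\<in>K. if y = 0 then 1 else (0 :: int))"
    using b by (simp add: F)
  also have "\<dots> = int q"
    by (simp add: card_K)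
  also have "(\<Sum>z\<in>K - {0}. \<Sum>x\<in>K. \<Sum>y\<in>K. if F (x * z, y * z, z) = 0 then 1 else 0) = (\<Sum>z\<in>K - {0}. int r)"
  proof (intro sum.cong refl)
    fix z assume z: "z \<in> K - {0}"
    have "(\<Sum>x\<in>K. \<Sum>y\<in>K. if F (x * z, y * z, z) = 0 then 1 else 0)
        = (\<Sum>y\<in>K. \<Sum>x\<in>K. if x = - h y then 1 else (0 :: int))"
      using z by (subst sum.swap) (simp add: F_scale eq_neg_iff_add_eq_0)
    also have "\<dots> = (\<Sum>y\<in>K. if h y \<in> K then 1 else 0)"
    proof (intro sum.cong refl)
      fix y
      have "- h y \<in> K \<longleftrightarrow> h y \<in> K"
        using K_closed(7) by (metis minus_minus)
      then show "(\<Sum>x\<in>K. if x = - h y then 1 else 0) = (if h y \<in> K then 1 else (0 :: int))"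
        by simp
    qed
    finally show "(\<Sum>x\<in>K. \<Sum>y\<in>K. if F (x * z, y * z, z) = 0 then 1 else 0) = int r"
      by (simp add: sum_r)
  qed
  also have "\<dots> = (int q - 1) * int r"
    by (rule sum_K0)
  finally have "int (card {v \<in> K \<times> K \<times> K. F v = 0}) = int (q + (q - 1) * r)"
    using q_ge_3 by (simp add: of_nat_diff)
  then show "card {v \<in> K \<times> K \<times> K. F v = 0} = q + (q - 1) * r"
    by (simp only: of_nat_eq_iff)
  have "(\<Sum>v \<in> K \<times> K \<times> K. chi (b * F v)) = (\<Sum>x\<in>K. \<Sum>y\<in>K. chi (b * F (x, y, 0)))
      + (\<Sum>z\<in>K - {0}. \<Sum>x\<in>K. \<Sum>y\<in>K. chi (b * F (x * z, y * z, z)))"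
    by (rule sum_K3)
  also have "(\<Sum>x\<in>K. \<Sum>y\<in>K. chi (b * F (x, y, 0))) = (\<Sum>x\<in>K. \<Sum>y\<in>K. chi y * chi y)"
  proof (intro sum.cong refl)
    fix y
    have "b * F (x, y, 0) = (b * y) ^ 2" for x
      by (simp add: F power2_eq_square)
    then show "chi (b * F (x, y, 0)) = chi y * chi y" for x
      using b chi_square[of b] by (simp add: chi_mult power2_eq_square)
  qed
  also have "\<dots> = int q * (\<Sum>y\<in>K. chi y)"
  proof -
    have "chi y * chi y = chi y" if "y \<in> K" for y
      using that by (cases "y = 0") simp_all
    then have "(\<Sum>y\<in>K. chi y * chi y) = (\<Sum>y\<in>K. chi y)"
      by (rule sum.cong[OF refl])
    then show ?thesis
      by (simp add: card_K)
  qed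
  also have "\<dots> = int q * (int q - 1)"
    by (simp add: sum_chi_K)
  also have "(\<Sum>z\<in>K - {0}. \<Sum>x\<in>K. \<Sum>y\<in>K. chi (b * F (x * z, y * z, z)))
      = (\<Sum>z\<in>K - {0}. int q * (chi b * (int r - 1)))"
  proof (intro sum.cong refl)
    fix z assume z: "z \<in> K - {0}"
    have "chi (b * F (x * z, y * z, z)) = chi b * chi (x + h y)" for x y
      unfolding F_scale using z by (simp add: chi_mult)
    then have "(\<Sum>x\<in>K. \<Sum>y\<in>K. chi (b * F (x * z, y * z, z))) = (\<Sum>x\<in>K. \<Sum>y\<in>K. chi b * chi (x + h y))"
      by simp
    also have "\<dots> = chi b * (\<Sum>y\<in>K. \<Sum>x\<in>K. chi (x + h y))"
      by (subst sum.swap) (simp add: sum_distrib_left)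
    also have "\<dots> = chi b * (int r * (int q - 1) + (int q - int r) * (- 1))"
      unfolding sum_chi_shift sum_r ..
    finally show "(\<Sum>x\<in>K. \<Sum>y\<in>K. chi (b * F (x * z, y * z, z))) = int q * (chi b * (int r - 1))"
      by (simp add: algebra_simps)
  qed
  also have "\<dots> = (int q - 1) * (int q * (chi b * (int r - 1)))"
    by (rule sum_K0)
  finally show "(\<Sum>v \<in> K \<times> K \<times> K. chi (b * F v)) = (int q - 1) * int q * (1 + chi b * (int r - 1))"
    by (simp add: algebra_simps)
qed

text \<open>The discriminant is \<open>b * e * e\<close>, so \<open>b\<close> and \<open>e\<close>
  are nonzero and division by \<open>e\<close> reaches the normalised form; the square class changes
  only by the fourth power of \<open>e\<close>. Here \<open>n\<close> is \<open>r \<le> 2\<close>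
  and \<open>t\<close> is \<open>1 + chi (b / e) * (r - 1)\<close>.\<close>

lemma counts_dependent:
  fixes b c e f :: 'k
  assumes disc: "qdisc (0, b, c, 0, e, f) \<noteq> 0" and not_K: "\<not> {b / e, f / e, c / e} \<subseteq> K"
  shows "\<exists>(n, t) \<in> {(0, 0), (0, 2), (1, 1), (2, 0), (2, 2)}.
      int (card {v \<in> K \<times> K \<times> K. qeval (0, b, c, 0, e, f) v = 0}) = int q + (int q - 1) * n \<and>
      (\<Sum>v \<in> K \<times> K \<times> K. chi (qdisc (0, b, c, 0, e, f) * qeval (0, b, c, 0, e, f) v))
          = (int q - 1) * int q * t"
proof -
  let ?b = "b / e"
  let ?F = "qeval (0, b / e, c / e, 0, 1, f / e)"
  have nz: "b \<noteq> 0" "e \<noteq> 0"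
    using disc by auto
  then have b: "?b \<noteq> 0"
    by simp
  have F: "qeval (0, b, c, 0, e, f) v = e * ?F v" for v
    using nz by (cases v) (simp add: field_simps)
  have "chi (qdisc (0, b, c, 0, e, f) * qeval (0, b, c, 0, e, f) v) = chi (?b * ?F v)" for v
  proof -
    have "qdisc (0, b, c, 0, e, f) * (e * s) = (e ^ 2) ^ 2 * (?b * s)" for s
      using nz by (simp add: power2_eq_square)
    then show ?thesis
      unfolding F using nz chi_square[of "e ^ 2"] by (simp only: chi_mult[of "(e ^ 2) ^ 2"]) simp
  qed
  moreover define r where "r = card {y \<in> K. ?b * y ^ 2 + f / e * y + c / e \<in> K}"
  ultimately have
    S: "(\<Sum>v \<in> K \<times> K \<times> K. chi (qdisc (0, b, c, 0, e, f) * qeval (0, b, c, 0, e, f) v))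
        = (int q - 1) * int q * (1 + chi ?b * (int r - 1))"
    using counts_normalised(2)[OF b, of "c / e" "f / e"] by simp
  have "card {v \<in> K \<times> K \<times> K. qeval (0, b, c, 0, e, f) v = 0} = q + (q - 1) * r"
    using counts_normalised(1)[OF b, of "c / e" "f / e"] nz unfolding F r_def by simp
  then have N: "int (card {v \<in> K \<times> K \<times> K. qeval (0, b, c, 0, e, f) v = 0}) = int q + (int q - 1) * int r"
    using q_ge_3 by (simp add: of_nat_diff)
  have "r \<le> 2"
    unfolding r_def using not_K by (rule card_quadratic_in_K_le)
  then have "(int r, 1 + chi ?b * (int r - 1)) \<in> {(0, 0), (0, 2), (1, 1), (2, 0), (2, 2)}"
    using chi_nonzero_cases[OF b] by (auto simp: le_Suc_eq numeral_2_eq_2)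
  then show ?thesis
    by (rule bexI[rotated]) (simp only: prod.case N S)
qed

section \<open>From rational points to rational vectors\<close>

text \<open>The factor between two proportional rational vectors is a quotient of coordinates, hence
  in \<open>K\<close>.\<close>

lemma pclass_fibre:
  assumes v: "v \<in> K \<times> K \<times> K" "v \<noteq> (0, 0, 0)"
  shows "{w \<in> K \<times> K \<times> K. w \<noteq> (0, 0, 0) \<and> pclass w = pclass v} = (\<lambda>k. smul k v) ` (K - {0})"
proof (intro equalityI subsetI)
  fix w assume "w \<in> {w \<in> K \<times> K \<times> K. w \<noteq> (0, 0, 0) \<and> pclass w = pclass v}"
  then have w: "w \<in> K \<times> K \<times> K" "pclass v = pclass w"
    by auto
  then obtain k where k: "k \<noteq> 0" "w = smul k v"
    by (auto simp: pclass_eq_iff)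
  obtain x where x: "x \<in> K" "x \<noteq> 0" "k * x \<in> K"
    using v w(1) k by (cases v) (auto simp: smul_def)
  then have "k \<in> K"
    using K_closed(6)[of "k * x" x] by (metis nonzero_mult_div_cancel_right)
  then show "w \<in> (\<lambda>k. smul k v) ` (K - {0})"
    using k x by auto
next
  fix w assume "w \<in> (\<lambda>k. smul k v) ` (K - {0})"
  then obtain k where k: "k \<in> K" "k \<noteq> 0" "w = smul k v"
    by blast
  then have "pclass v = pclass w"
    by (auto simp: pclass_eq_iff)
  moreover have "w \<in> K \<times> K \<times> K"
    using v k by (cases v) (auto simp: smul_def)
  ultimately show "w \<in> {w \<in> K \<times> K \<times> K. w \<noteq> (0, 0, 0) \<and> pclass w = pclass v}"
    using v k by simp
qed

lemma ppoints_q_eq: "ppoints_q q = pclass ` (K \<times> K \<times> K - {(0, 0, 0)})"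
proof (intro equalityI subsetI)
  fix P :: "'k vec3 set" assume "P \<in> ppoints_q q"
  then obtain w where w: "P \<in> ppoints" "w \<in> P" "w \<in> K \<times> K \<times> K"
    by (auto simp: ppoints_q_def K_eq mem_Times_iff)
  obtain v where v: "v \<noteq> (0, 0, 0)" "P = pclass v"
    using w(1) by (rule ppointsE)
  then obtain c where "c \<noteq> 0" "w = smul c v"
    using w(2) by (auto simp: pclass_smul_def)
  then have "P = pclass w" "w \<noteq> (0, 0, 0)"
    using v by (auto simp: pclass_eq_iff)
  then show "P \<in> pclass ` (K \<times> K \<times> K - {(0, 0, 0)})"
    using w(3) by blast
next
  fix P assume "P \<in> pclass ` (K \<times> K \<times> K - {(0, 0, 0)})"
  then obtain w where "P = pclass w" "w \<in> K \<times> K \<times> K" "w \<noteq> (0, 0, 0)"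
    by blast
  then show "P \<in> ppoints_q q"
    using self_in_pclass[of w] by (auto simp: ppoints_q_def K_eq mem_Times_iff simp del: split_paired_Ex)
qed

text \<open>Each rational point has exactly \<open>q - 1\<close> rational representatives.\<close>

lemma card_points_eq_card_vectors:
  assumes "\<And>v. v \<in> K \<times> K \<times> K \<Longrightarrow> v \<noteq> (0, 0, 0) \<Longrightarrow> R (pclass v) \<longleftrightarrow> S v" and "\<not> S (0, 0, 0)"
  shows "(q - 1) * card {P \<in> ppoints_q q. R P} = card {v \<in> K \<times> K \<times> K. S v}"
proof -
  let ?V = "{v \<in> K \<times> K \<times> K. S v}"
  have V: "v \<noteq> (0, 0, 0)" if "v \<in> ?V" for v
    using that assms(2) by auto
  have image: "pclass ` ?V = {P \<in> ppoints_q q. R P}"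
  proof (intro equalityI subsetI)
    fix P assume "P \<in> pclass ` ?V"
    then obtain v where "v \<in> ?V" "P = pclass v"
      by blast
    then show "P \<in> {P \<in> ppoints_q q. R P}"
      unfolding ppoints_q_eq using V assms(1) by blast
  next
    fix P assume "P \<in> {P \<in> ppoints_q q. R P}"
    then obtain v where "v \<in> K \<times> K \<times> K" "v \<noteq> (0, 0, 0)" "P = pclass v" "R (pclass v)"
      unfolding ppoints_q_eq by blast
    then show "P \<in> pclass ` ?V"
      using assms(1) by blast
  qed
  have fibre: "card {v \<in> ?V. pclass v = P} = q - 1" if P: "P \<in> pclass ` ?V" for P
  proof -
    obtain v where v: "v \<in> ?V" "P = pclass v"
      using P by blast
    have "{w \<in> ?V. pclass w = P} = {w \<in> K \<times> K \<times> K. w \<noteq> (0, 0, 0) \<and> pclass w = pclass v}"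
    proof (intro equalityI subsetI)
      fix w assume "w \<in> {w \<in> ?V. pclass w = P}"
      then show "w \<in> {w \<in> K \<times> K \<times> K. w \<noteq> (0, 0, 0) \<and> pclass w = pclass v}"
        using V v by blast
    next
      fix w assume w: "w \<in> {w \<in> K \<times> K \<times> K. w \<noteq> (0, 0, 0) \<and> pclass w = pclass v}"
      then have "R (pclass w)"
        using assms(1)[of v] v V by auto
      then show "w \<in> {w \<in> ?V. pclass w = P}"
        using w v assms(1)[of w] by blast
    qed
    also have "\<dots> = (\<lambda>k. smul k v) ` (K - {0})"
      using v V by (intro pclass_fibre) auto
    finally show ?thesis
      using V[OF v(1)] card_Diff_singleton[of 0 K]
      by (simp add: card_image inj_on_def smul_right_cancel card_K)
  qed
  have "card ?V = (\<Sum>P\<in>pclass ` ?V. card {v \<in> ?V. pclass v = P})"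
    by (rule card_eq_sum_fibres) simp
  then show ?thesis
    using fibre image by simp
qed

text \<open>Twice the indicator of \<open>chi = 1\<close> is \<open>1 + chi\<close>, less
  \<open>1\<close> at the zeros of \<open>Q\<close>. Summing over the \<open>q ^ 3\<close> rational
  vectors gives the formula; the zero vector is among the zeros and contributes nothing.\<close>

lemma E_q_eq:
  fixes Q :: "'k qform"
  assumes Q: "qdisc Q \<noteq> 0"
  shows "2 * (int q - 1) * int (E_q q Q) = int q ^ 3 - int (card {v \<in> K \<times> K \<times> K. qeval Q v = 0})
    + (\<Sum>v \<in> K \<times> K \<times> K. chi (qdisc Q * qeval Q v))"
proof -
  let ?V = "K \<times> K \<times> K"
  let ?x = "\<lambda>v. chi (qdisc Q * qeval Q v)"
  have "qeval Q (0, 0, 0) = 0"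
    by (cases Q) simp
  then have "(q - 1) * E_q q Q = card {v \<in> ?V. ?x v = 1}"
    unfolding E_q_def using Q by (intro card_points_eq_card_vectors external_iff) auto
  then have E: "(int q - 1) * int (E_q q Q) = int (card {v \<in> ?V. ?x v = 1})"
    using q_ge_3 by (metis (no_types, lifting) of_nat_1 of_nat_diff of_nat_mult one_le_numeral order_trans)
  have ind: "int (card {v \<in> ?V. R v}) = (\<Sum>v\<in>?V. if R v then 1 else 0)" for R
    by (simp add: sum.If_cases Int_def)
  have "2 * int (card {v \<in> ?V. ?x v = 1}) = (\<Sum>v\<in>?V. 2 * (if ?x v = 1 then 1 else 0))"
    unfolding ind sum_distrib_left ..
  also have "\<dots> = (\<Sum>v\<in>?V. 1 - (if qeval Q v = 0 then 1 else 0) + ?x v)"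
  proof (rule sum.cong[OF refl])
    fix v
    show "2 * (if ?x v = 1 then 1 else 0) = 1 - (if qeval Q v = 0 then 1 else 0) + ?x v"
    proof (cases "qeval Q v = 0")
      case False
      then have "?x v = 1 \<or> ?x v = - 1"
        using Q by (intro chi_nonzero_cases) simp
      then show ?thesis
        using False by auto
    qed simp
  qed
  also have "\<dots> = int (card ?V) - int (card {v \<in> ?V. qeval Q v = 0}) + (\<Sum>v\<in>?V. ?x v)"
    by (simp only: sum.distrib sum_subtractf ind) simp
  also have "int (card ?V) = int q ^ 3"
    by (simp add: card_cartesian_product card_K power3_eq_cube)
  finally show ?thesis
    using E by (simp only: mult.assoc)
qed

section \<open>Invariance under rational changes of basis\<close>

lemma lincomb_image_K3:
  assumes "u \<in> K \<times> K \<times> K" "v \<in> K \<times> K \<times> K" "w \<in> K \<times> K \<times> K" and det: "det3 u v w \<noteq> 0"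
  shows "lincomb u v w ` (K \<times> K \<times> K) = K \<times> K \<times> K"
proof (intro equalityI subsetI)
  fix z assume "z \<in> lincomb u v w ` (K \<times> K \<times> K)"
  then show "z \<in> K \<times> K \<times> K"
    using assms by (cases u; cases v; cases w) auto
next
  fix z assume "z \<in> K \<times> K \<times> K"
  then have "(det3 z v w / det3 u v w, det3 u z w / det3 u v w, det3 u v z / det3 u v w) \<in> K \<times> K \<times> K"
    using assms(1-3) by (cases u; cases v; cases w; cases z) auto
  then show "z \<in> lincomb u v w ` (K \<times> K \<times> K)"
    using lincomb_cramer[OF det, of z] by (metis image_eqI)
qed

text \<open>The base change permutes the rational vectors and alters \<open>qdisc\<close> by a
  nonzero square, which \<open>chi\<close> ignores.\<close>

lemma counts_qchange:
  fixes Q :: "'k qform"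
  assumes uvw: "u \<in> K \<times> K \<times> K" "v \<in> K \<times> K \<times> K" "w \<in> K \<times> K \<times> K" and det: "det3 u v w \<noteq> 0"
  defines "Q' \<equiv> qchange u v w Q"
  shows "card {x \<in> K \<times> K \<times> K. qeval Q' x = 0} = card {x \<in> K \<times> K \<times> K. qeval Q x = 0}"
    and "(\<Sum>x \<in> K \<times> K \<times> K. chi (qdisc Q' * qeval Q' x)) = (\<Sum>x \<in> K \<times> K \<times> K. chi (qdisc Q * qeval Q x))"
proof -
  let ?V = "K \<times> K \<times> K" and ?L = "lincomb u v w"
  have inj: "inj ?L"
    by (rule injI) (simp add: lincomb_inject[OF det])
  have image: "?L ` ?V = ?V"
    using uvw det by (rule lincomb_image_K3)
  have qeval: "qeval Q' x = qeval Q (?L x)" for x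
    by (simp add: Q'_def qeval_lincomb)
  have "{x \<in> ?V. qeval Q x = 0} = {x \<in> ?L ` ?V. qeval Q x = 0}"
    by (simp only: image)
  also have "\<dots> = ?L ` {x \<in> ?V. qeval Q' x = 0}"
    by (auto simp: qeval simp del: split_paired_All split_paired_Ex)
  finally show "card {x \<in> ?V. qeval Q' x = 0} = card {x \<in> ?V. qeval Q x = 0}"
    using inj by (simp add: card_image inj_on_subset)
  have "(\<Sum>x\<in>?V. chi (qdisc Q * qeval Q x)) = (\<Sum>x\<in>?L ` ?V. chi (qdisc Q * qeval Q x))"
    by (simp only: image)
  also have "\<dots> = (\<Sum>x\<in>?V. chi (qdisc Q * qeval Q (?L x)))"
    using inj by (subst sum.reindex) (auto intro: inj_on_subset)
  also have "\<dots> = (\<Sum>x\<in>?V. chi (qdisc Q' * qeval Q' x))"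
  proof (intro sum.cong refl)
    fix x
    have "qdisc Q' * qeval Q' x = det3 u v w ^ 2 * (qdisc Q * qeval Q (?L x))"
      unfolding qeval by (simp add: Q'_def qdisc_qchange)
    then show "chi (qdisc Q * qeval Q (?L x)) = chi (qdisc Q' * qeval Q' x)"
      using chi_square[OF det] by (simp only: chi_mult[of "det3 u v w ^ 2"] mult_1)
  qed
  finally show "(\<Sum>x\<in>?V. chi (qdisc Q' * qeval Q' x)) = (\<Sum>x\<in>?V. chi (qdisc Q * qeval Q x))"
    by simp
qed

text \<open>A coordinate-free criterion, from which invariance under base change is immediate. The
  coefficients are recovered from the values at the unit vectors and at their pairwise sums.\<close>

lemma defined_over_q_iff:
  fixes Q :: "'k qform"
  shows "defined_over_q q Q \<longleftrightarrow> (\<exists>s. \<forall>v \<in> K \<times> K \<times> K. \<exists>k\<in>K. qeval Q v = s * k)"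
proof -
  have unfolded: "defined_over_q q Q \<longleftrightarrow> (\<exists>s a b c d e f. {a, b, c, d, e, f} \<subseteq> K \<and> Q = (s*a, s*b, s*c, s*d, s*e, s*f))"
    unfolding K_eq by (cases Q) (simp only: defined_over_q.simps)
  show ?thesis
  proof
    assume "defined_over_q q Q"
    then obtain s a b c d e f where K: "{a, b, c, d, e, f} \<subseteq> K" and Q: "Q
        = (s*a, s*b, s*c, s*d, s*e, s*f)"
      unfolding unfolded by blast
    have "\<exists>k\<in>K. qeval Q v = s * k" if "v \<in> K \<times> K \<times> K" for v
    proof -
      obtain x y z where v: "v = (x, y, z)" "x \<in> K" "y \<in> K" "z \<in> K"
        using \<open>v \<in> K \<times> K \<times> K\<close> by auto
      have "qeval Q v = s * qeval (a, b, c, d, e, f) v"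
        by (simp add: Q v algebra_simps)
      moreover have "qeval (a, b, c, d, e, f) v \<in> K"
        using K v by simp
      ultimately show ?thesis
        by blast
    qed
    then show "\<exists>s. \<forall>v \<in> K \<times> K \<times> K. \<exists>k\<in>K. qeval Q v = s * k"
      by blast
  next
    assume "\<exists>s. \<forall>v \<in> K \<times> K \<times> K. \<exists>k\<in>K. qeval Q v = s * k"
    then obtain s where s: "\<And>v. v \<in> K \<times> K \<times> K \<Longrightarrow> \<exists>k\<in>K. qeval Q v = s * k"
      by blast
    obtain a b c d e f where Q: "Q = (a, b, c, d, e, f)"
      by (cases Q)
    obtain a' b' c' where 1: "a' \<in> K" "b' \<in> K" "c' \<in> K" "a = s * a'" "b = s * b'" "c = s * c'"
      using s[of "(1, 0, 0)"] s[of "(0, 1, 0)"] s[of "(0, 0, 1)"] by (auto simp: Q)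
    obtain d' e' f' where 2: "d' \<in> K" "e' \<in> K" "f' \<in> K" "a + b + d = s * d'" "a + c + e = s * e'" "b + c + f = s * f'"
      using s[of "(1, 1, 0)"] s[of "(1, 0, 1)"] s[of "(0, 1, 1)"] by (auto simp: Q)
    have "d = s * (d' - a' - b')" "e = s * (e' - a' - c')" "f = s * (f' - b' - c')"
      by (simp_all only: right_diff_distrib 2(4-6)[symmetric] 1(4-6)[symmetric]) simp_all
    then have "Q = (s * a', s * b', s * c', s * (d' - a' - b'), s * (e' - a' - c'), s * (f' - b' - c'))"
      using 1 by (simp add: Q)
    moreover have "{a', b', c', d' - a' - b', e' - a' - c', f' - b' - c'} \<subseteq> K"
      using 1 2 by simp
    ultimately show "defined_over_q q Q"
      unfolding unfolded by blast
  qed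
qed

lemma defined_over_q_qchange:
  fixes Q :: "'k qform"
  assumes "u \<in> K \<times> K \<times> K" "v \<in> K \<times> K \<times> K" "w \<in> K \<times> K \<times> K" "det3 u v w \<noteq> 0"
  shows "defined_over_q q (qchange u v w Q) \<longleftrightarrow> defined_over_q q Q"
proof -
  have "(\<forall>x \<in> K \<times> K \<times> K. \<exists>k\<in>K. qeval (qchange u v w Q) x = s * k)
      \<longleftrightarrow> (\<forall>x \<in> lincomb u v w ` (K \<times> K \<times> K). \<exists>k\<in>K. qeval Q x = s * k)" for s
    by (simp only: qeval_lincomb ball_simps)
  then show ?thesis
    unfolding defined_over_q_iff lincomb_image_K3[OF assms] by simp
qed

text \<open>Here \<open>n\<close> counts the rational points of the conic other than the base point,
  and \<open>t\<close> is the character sum divided by \<open>q * (q - 1)\<close>. The pairs are the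
  union of those from the two cases.\<close>

lemma E_q_formula:
  fixes Q :: "'k qform"
  assumes disc: "qdisc Q \<noteq> 0" and not_K: "\<not> defined_over_q q Q" and pt: "conic Q \<inter> ppoints_q q \<noteq> {}"
  shows "\<exists>(n, t) \<in> {(0, 0), (0, 2), (1, 1), (1, -1), (2, 0), (2, 2), (3, 3), (3, -1)}.
    2 * int (E_q q Q) = int q ^ 2 + (t + 1) * int q - n"
proof -
  obtain p where p: "p \<in> K \<times> K \<times> K" "p \<noteq> (0, 0, 0)" "qeval Q p = 0"
  proof -
    obtain P where "P \<in> conic Q" "P \<in> pclass ` (K \<times> K \<times> K - {(0, 0, 0)})"
      using pt unfolding ppoints_q_eq by blast
    then obtain p where "p \<in> K \<times> K \<times> K" "p \<noteq> (0, 0, 0)" "pclass p \<in> conic Q"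
      by blast
    with that show thesis
      by simp
  qed
  obtain i j where det: "det3 p i j \<noteq> 0" and ij: "{i, j} \<subseteq> {(1, 0, 0), (0, 1, 0), (0, 0, 1)}"
    using p(2) by (rule basis_completion)
  have ijK: "i \<in> K \<times> K \<times> K" "j \<in> K \<times> K \<times> K"
    using ij by auto
  define Q1 where "Q1 = qchange p i j Q"
  obtain b c d e f where Q1: "Q1 = (0, b, c, d, e, f)"
    using p(3) by (simp add: Q1_def qchange_def)
  have disc1: "qdisc Q1 \<noteq> 0"
    using disc det by (simp add: Q1_def qdisc_qchange)
  have not_K1: "\<not> defined_over_q q Q1"
    unfolding Q1_def using not_K defined_over_q_qchange[OF p(1) ijK det] by simp
  note counts1 = counts_qchange[OF p(1) ijK det, of Q, folded Q1_def]
  let ?N = "\<lambda>Q. int (card {v \<in> K \<times> K \<times> K. qeval Q v = 0})"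
  let ?S = "\<lambda>Q. \<Sum>v \<in> K \<times> K \<times> K. chi (qdisc Q * qeval Q v)"
  have "\<exists>(n, t) \<in> {(0, 0), (0, 2), (1, 1), (1, -1), (2, 0), (2, 2), (3, 3), (3, -1)}.
      ?N Q = int q + (int q - 1) * n \<and> ?S Q = (int q - 1) * int q * t"
  \<comment> \<open>The tangent at \<open>p\<close> is \<open>d * y + e * z = 0\<close>; the case
    distinction is whether it contains another rational point.\<close>
  proof (cases "\<forall>y\<in>K. \<forall>z\<in>K. d * y + e * z = 0 \<longrightarrow> y = 0 \<and> z = 0")
    case True
    then have "\<exists>(n, t) \<in> {(0, 0), (1, 1), (1, -1), (2, 0), (2, 2), (3, 3), (3, -1)}.
        ?N Q1 = int q + (int q - 1) * n \<and> ?S Q1 = (int q - 1) * int q * t"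
      using counts_independent disc1 unfolding Q1 by blast
    then show ?thesis
      unfolding counts1 by blast
  next
    case False
    then obtain y z where yz: "y \<in> K" "z \<in> K" "d * y + e * z = 0" "y \<noteq> 0 \<or> z \<noteq> 0"
      by blast
    \<comment> \<open>The second basis vector is a further rational point of the tangent at
      \<open>u\<close>, which makes the mixed coefficient \<open>polar Q1 u v\<close>
      vanish.\<close>
    define u v w :: "'k vec3" where uvw: "u = (1, 0, 0)" "v = (0, y, z)"
      "w = (if y \<noteq> 0 then (0, 0, 1) else (0, 1, 0))"
    have det2: "det3 u v w \<noteq> 0"
      using yz by (simp add: uvw)
    have K2: "u \<in> K \<times> K \<times> K" "v \<in> K \<times> K \<times> K" "w \<in> K \<times> K \<times> K"
      using yz by (simp_all add: uvw)
    define Q2 where "Q2 = qchange u v w Q1"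
    obtain b' c' e' f' where Q2: "Q2 = (0, b', c', 0, e', f')"
      using yz(3) by (simp add: Q2_def qchange_def Q1 uvw)
    have disc2: "qdisc Q2 \<noteq> 0"
      using disc1 det2 by (simp add: Q2_def qdisc_qchange)
    note counts2 = counts_qchange[OF K2 det2, of Q1, folded Q2_def]
    \<comment> \<open>Otherwise \<open>Q2\<close> would be \<open>e'\<close> times a form over
      \<open>K\<close>.\<close>
    have "\<not> {b' / e', f' / e', c' / e'} \<subseteq> K"
    proof
      assume "{b' / e', f' / e', c' / e'} \<subseteq> K"
      moreover have "e' \<noteq> 0"
        using disc2 unfolding Q2 by auto
      ultimately have "{0, b' / e', c' / e', 0, 1, f' / e'} \<subseteq> subfield_q q"
        "Q2 = (e' * 0, e' * (b' / e'), e' * (c' / e'), e' * 0, e' * 1, e' * (f' / e'))"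
        by (simp_all add: Q2 flip: K_eq)
      then have "defined_over_q q Q2"
        unfolding Q2 defined_over_q.simps by blast
      then show False
        using not_K1 defined_over_q_qchange[OF K2 det2, of Q1] by (simp add: Q2_def)
    qed
    then have "\<exists>(n, t) \<in> {(0, 0), (0, 2), (1, 1), (2, 0), (2, 2)}.
        ?N Q2 = int q + (int q - 1) * n \<and> ?S Q2 = (int q - 1) * int q * t"
      using counts_dependent disc2 unfolding Q2 by blast
    then show ?thesis
      unfolding counts2 counts1 by blast
  qed
  then obtain n t where nt: "(n, t) \<in> {(0, 0), (0, 2), (1, 1), (1, -1), (2, 0), (2, 2), (3, 3), (3, -1 :: int)}"
    "?N Q = int q + (int q - 1) * n" "?S Q = (int q - 1) * int q * t"
    by blast
  have "(int q - 1) * (2 * int (E_q q Q))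
      = int q ^ 3 - (int q + (int q - 1) * n) + (int q - 1) * int q * t"
    using E_q_eq[OF disc] unfolding nt(2,3) by (simp only: ac_simps)
  also have "\<dots> = (int q - 1) * (int q ^ 2 + (t + 1) * int q - n)"
    by Groebner_Basis.algebra
  finally have "2 * int (E_q q Q) = int q ^ 2 + (t + 1) * int q - n"
    using q_ge_3 by simp
  then show ?thesis
    by (intro bexI[OF _ nt(1)]) simp
qed

end

theorem theorem1p2:
  fixes q :: nat and Q :: "'k::{field,finite} qform"
  assumes q_pp: "\<exists>p k. prime p \<and> k > 0 \<and> q = p ^ k"
    and q_odd: "odd q"
    and card_k: "card (UNIV :: 'k set) = q ^ 2"
    and irr: "abs_irreducible Q"
    and not_q: "\<not> defined_over_q q Q"
    and has_pt: "conic Q \<inter> ppoints_q q \<noteq> {}"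
  shows "(q = 3 \<longrightarrow> E_q q Q \<in> {3, 4, 5, 6, 7, 8, 9})
       \<and> (q = 5 \<longrightarrow> E_q q Q \<in> {11, 12, 14, 15, 16, 17, 19, 20, 21, 22, 25})
       \<and> (q > 5 \<longrightarrow> (\<exists>n0 \<in> {0, 1, 2, 3}. \<exists>al \<in> {1, 2, 3, 4, 5, 7}. even (al - n0) \<and>
              2 * int (E_q q Q) = int q ^ 2 + (al - 1) * int q - n0))"
proof -
  interpret quadratic_extension q "subfield_q q :: 'k set"
    using q_pp q_odd card_k by unfold_locales auto
  obtain n t where nt: "(n, t) \<in> {(0, 0), (0, 2), (1, 1), (1, -1), (2, 0), (2, 2), (3, 3), (3, -1 :: int)}"
    and E: "2 * int (E_q q Q) = int q ^ 2 + (t + 1) * int q - n"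
    using E_q_formula[OF qdisc_nonzero[OF two_nonzero irr] not_q has_pt] by blast
  \<comment> \<open>For a fixed \<open>q\<close> each of the eight pairs determines one value of
    \<open>E_q\<close>.\<close>
  have "E_q q Q \<in> {3, 4, 5, 6, 7, 8, 9}" if "q = 3"
    using nt E that by auto
  moreover have "E_q q Q \<in> {11, 12, 14, 15, 16, 17, 19, 20, 21, 22, 25}" if "q = 5"
    using nt E that by auto
  \<comment> \<open>In every pair \<open>n\<close> and \<open>t\<close> have the same parity, and
    \<open>t + 2\<close> lies between \<open>1\<close> and \<open>5\<close>.\<close>
  moreover have "\<exists>n0 \<in> {0, 1, 2, 3}. \<exists>al \<in> {1, 2, 3, 4, 5, 7}. even (al - n0) \<and>
      2 * int (E_q q Q) = int q ^ 2 + (al - 1) * int q - n0"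
    using nt E by (intro bexI[of _ n] bexI[of _ "t + 2"]) auto
  ultimately show ?thesis
    by blast
qed

end
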